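(* For all integers $n,a,b,c\ge 1$, $$\mathrm{topo}(G_S(n,a,b,c))=\left(n(a+b-1)+\binom{n}{2}\cdot 2c\right)!\prod_{j=0}^{n-1}\frac{(a+cj-1)!\,(b+cj-1)!\,(c+cj-1)!}{(c-1)!\,(a+b+(j+n-1)c-1)!}.$$
   Context: For a directed acyclic graph $G=(V,E)$ with $|V|$ vertices, a topological ordering is a bijection $f:V\to\{1,\dots,|V|\}$ such that $f(u)>f(v)$ for every directed edge $u\to v$; $\mathrm{topo}(G)$ denotes the number of topological orderings of $G$. For integers $n,a,b,c\ge1$, $G_S(n,a,b,c)$ is the directed graph with vertex set consisting of $x_1,\dots,x_n$; $p_{i,k}$ for $i\in[n]$, $k\in[a-1]$; $q_{i,k}$ for $i\in[n]$, $k\in[b-1]$; and $r_{i,j,k}$ for $1\le i<j\le n$, $k\in[2c]$; and edges $x_{i+1}\to x_i$ for $i\in[n-1]$; $x_i\to p_{i,k}$ for all $i,k$; $q_{i,k}\to x_i$ for all $i,k$; and $x_j\to r_{i,j,k}\to x_i$ (two edges) for all $1\le i<j\le n$, $k\in[2c]$. Here $[m]=\{1,\dots,m\}$ (empty if $m\le 0$). *)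

theory Defs
  imports Complex_Main "HOL-Library.FuncSet" "Graph_Theory.Pair_Digraph"
begin

text \<open>A topological ordering is a function on the vertex set only; the condition
  \<^term>\<open>f \<in> extensional (pverts G)\<close> fixes its values elsewhere, so that each
  ordering is counted exactly once. Labels decrease along arcs.\<close>

definition topological_orderings :: "'a pair_pre_digraph \<Rightarrow> ('a \<Rightarrow> nat) set" where
  "topological_orderings G =
     {f \<in> extensional (pverts G).
        bij_betw f (pverts G) {1..card (pverts G)} \<and>
        (\<forall>(u, v) \<in> parcs G. f u > f v)}"

definition topo :: "'a pair_pre_digraph \<Rightarrow> nat" where
  "topo G = card (topological_orderings G)"

datatype selberg_vertex = X nat | P nat nat | Q nat nat | R nat nat nat

definition G_S :: "nat \<Rightarrow> nat \<Rightarrow> nat \<Rightarrow> nat \<Rightarrow> selberg_vertex pair_pre_digraph" where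
  "G_S n a b c = \<lparr>
     pverts =
       {X i | i. i \<in> {1..n}} \<union>
       {P i k | i k. i \<in> {1..n} \<and> k \<in> {1..a - 1}} \<union>
       {Q i k | i k. i \<in> {1..n} \<and> k \<in> {1..b - 1}} \<union>
       {R i j k | i j k. 1 \<le> i \<and> i < j \<and> j \<le> n \<and> k \<in> {1..2 * c}},
     parcs =
       {(X (i + 1), X i) | i. i \<in> {1..n - 1}} \<union>
       {(X i, P i k) | i k. i \<in> {1..n} \<and> k \<in> {1..a - 1}} \<union>
       {(Q i k, X i) | i k. i \<in> {1..n} \<and> k \<in> {1..b - 1}} \<union>
       {(X j, R i j k) | i j k. 1 \<le> i \<and> i < j \<and> j \<le> n \<and> k \<in> {1..2 * c}} \<union>
       {(R i j k, X i) | i j k. 1 \<le> i \<and> i < j \<and> j \<le> n \<and> k \<in> {1..2 * c}}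
   \<rparr>"

lemma acyclic_G_S: "acyclic (parcs (G_S n a b c))"
proof -
  define rank :: "selberg_vertex \<Rightarrow> nat" where
    "rank v = (case v of X i \<Rightarrow> 2 * i | P i k \<Rightarrow> 0 | Q i k \<Rightarrow> 2 * n + 1 | R i j k \<Rightarrow> 2 * j - 1)" for v
  have "parcs (G_S n a b c) \<subseteq> (measure rank)\<inverse>"
    by (auto simp: G_S_def rank_def)
  moreover have "acyclic ((measure rank)\<inverse>)"
    by (simp add: wf_acyclic)
  ultimately show ?thesis
    by (rule acyclic_subset[rotated])
qed

lemma finite_pverts_G_S: "finite (pverts (G_S n a b c))"
proof -
  have "finite {(i, j, k). 1 \<le> i \<and> i < j \<and> j \<le> n \<and> k \<in> {1..2 * c}}"
    by (rule finite_subset[of _ "{..n} \<times> {..n} \<times> {1..2 * c}"]) auto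
  from finite_imageI[OF this, of "\<lambda>(i, j, k). R i j k"]
  have "finite {R i j k | i j k. 1 \<le> i \<and> i < j \<and> j \<le> n \<and> k \<in> {1..2 * c}}"
    by (rule rev_finite_subset) (auto simp: image_iff)
  then show ?thesis
    by (simp add: G_S_def finite_image_set2
        del: atLeastAtMost_iff)
qed

lemma pair_fin_digraph_G_S: "pair_fin_digraph (G_S n a b c)"
proof -
  have sub: "parcs (G_S n a b c) \<subseteq> pverts (G_S n a b c) \<times> pverts (G_S n a b c)"
    by (auto simp: G_S_def)
  then have "finite (parcs (G_S n a b c))"
    using finite_cartesian_product[OF finite_pverts_G_S finite_pverts_G_S]
    by (rule finite_subset)
  then show ?thesis
    using sub finite_pverts_G_S by (intro pair_fin_digraph.intro pair_wf_digraph.intro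
      pair_fin_digraph_axioms.intro) auto
qed

end

theory Submission
  imports Defs "HOL-Probability.Probability"
begin

text \<open>
  Label the vertices with independent uniform random reals. Every ranking of the labels is equally
  likely, so \<open>topo G / |V|!\<close> is the probability that the labels decrease along the arcs. Given the
  labels of \<open>x\<^sub>1, \<dots>, x\<^sub>n\<close>, the other vertices are independent, which makes this probability
  \<open>1 / n!\<close> times the Selberg integral of
  \<open>\<Prod>\<^sub>i x\<^sub>i ^ (a - 1) (1 - x\<^sub>i) ^ (b - 1) \<cdot> \<Prod>\<^sub>i\<^sub><\<^sub>j |x\<^sub>i - x\<^sub>j| ^ (2 c)\<close>. Aomoto's integration by parts
  relates its values at \<open>a\<close> and \<open>a + 1\<close>; at \<open>a = 1\<close> a boundary term reduces \<open>n\<close> to \<open>n - 1\<close>.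
\<close>

section \<open>The uniform measure on the cube\<close>

text \<open>The obstacle is that differentiating the weight produces terms with denominator x_i -
  x_j. Since c >= 1, the factor (x_i - x_j)^(2c) absorbs the pole, and symmetry under swapping i and
  j replaces the quotient by a polynomial. Passing from a to a + 1 multiplies the integrand by the
  product of all x_i, whereas one integration by parts brings in a single new factor. So the
  recursion runs through moments of products over subsets K, one element at a time. All exponents
  are natural numbers, so induction alone determines the integral, with no analytic continuation:
  outer induction on the number of variables, inner induction on A = a - 1. Removing a variable at A
  = 0 leaves the others with exponent 2c, so the outer hypothesis must hold for every A; B = b - 1
  and c stay fixed. Selberg's value has factors (c (j + 1))! / c! = (j + 1) (c + cj - 1)! / (c -
  1)!. Their parts j + 1 multiply to n! and cancel the 1 / n! that comes from ordering the
  x_i.\<close>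

definition unit_measure :: "real measure" where
  "unit_measure = restrict_space lborel {0..1}"

abbreviation cube :: "'i set \<Rightarrow> ('i \<Rightarrow> real) measure" where
  "cube I \<equiv> Pi\<^sub>M I (\<lambda>_. unit_measure)"

lemma space_unit_measure [simp]: "space unit_measure = {0..1}"
  by (simp add: unit_measure_def space_restrict_space)

lemma sets_unit_measure: "A \<in> sets borel \<Longrightarrow> A \<subseteq> {0..1} \<Longrightarrow> A \<in> sets unit_measure"
  unfolding unit_measure_def by (subst sets_restrict_space_iff) auto

lemma emeasure_unit_measure:
  "A \<in> sets borel \<Longrightarrow> A \<subseteq> {0..1} \<Longrightarrow> emeasure unit_measure A = emeasure lborel A"
  unfolding unit_measure_def by (subst emeasure_restrict_space) auto

lemma prob_space_unit_measure [simp]: "prob_space unit_measure"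
  by (rule prob_spaceI) (simp add: emeasure_unit_measure)

interpretation unit_measure: prob_space unit_measure
  by simp

interpretation cube: product_prob_space "\<lambda>_. unit_measure" I for I
  by standard

lemma measurable_unit_measure [measurable]: "(\<lambda>t. t) \<in> borel_measurable unit_measure"
  unfolding unit_measure_def by (rule measurable_restrict_space1) simp

lemma measurable_cube_component [measurable (raw)]:
  assumes "f \<in> measurable M (cube I)" "i \<in> I"
  shows "(\<lambda>x. f x i) \<in> borel_measurable M"
  using measurable_compose[OF measurable_compose[OF assms(1) measurable_component_singleton[OF assms(2)]]
      measurable_unit_measure] by simp

lemma space_cube: "space (cube I) = I \<rightarrow>\<^sub>E {0..1}"
  by (simp add: space_PiM)

lemma cube_component_bounds:
  "x \<in> space (cube I) \<Longrightarrow> i \<in> I \<Longrightarrow> 0 \<le> x i \<and> x i \<le> 1"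
  by (auto simp: space_cube PiE_def Pi_def)

lemma integrable_cube_bounded:
  fixes f :: "('i \<Rightarrow> real) \<Rightarrow> real"
  assumes "f \<in> borel_measurable (cube I)" "\<And>x. x \<in> space (cube I) \<Longrightarrow> \<bar>f x\<bar> \<le> C"
  shows "integrable (cube I) f"
  using assms by (intro cube.integrable_const_bound[where B = C]) auto

text \<open>Only polynomial integrands will occur, so differentiability is asked on the whole line
  and no one-sided derivatives at 0 and 1 arise.\<close>

lemma integral_unit_measure_FTC:
  fixes F f :: "real \<Rightarrow> real"
  assumes "\<And>t. (F has_real_derivative f t) (at t)" "continuous_on UNIV f"
  shows "(\<integral>t. f t \<partial>unit_measure) = F 1 - F 0"
proof -
  have "(\<integral>t. f t \<partial>unit_measure) = (\<integral>t. indicator {0..1} t *\<^sub>R f t \<partial>lborel)"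
    unfolding unit_measure_def by (subst integral_restrict_space) auto
  also have "\<dots> = F 1 - F 0"
    using assms by (intro integral_FTC_Icc)
      (auto simp: has_real_derivative_iff_has_vector_derivative
        intro: has_vector_derivative_at_within continuous_on_subset)
  finally show ?thesis .
qed

section \<open>Permuting coordinates of the cube, and the null set of ties\<close>

text \<open>A permutation of \<open>I\<close> fixes every point outside \<open>I\<close>, so
  \<open>x \<circ> \<pi>\<close> is again extensional. This lets plain composition replace
  restricted reindexing from here on.\<close>

lemma extensional_comp_permutes:
  assumes "\<pi> permutes I" "x \<in> extensional I"
  shows "(\<lambda>i\<in>I. x (\<pi> i)) = x \<circ> \<pi>"
  using assms by (auto simp: fun_eq_iff extensional_def permutes_def restrict_def)

lemma distr_cube_permutes:
  assumes "\<pi> permutes I"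
  shows "distr (cube I) (cube I) (\<lambda>x. x \<circ> \<pi>) = cube I"
proof -
  have "distr (cube I) (cube I) (\<lambda>x. x \<circ> \<pi>) = distr (cube I) (cube I) (\<lambda>x. \<lambda>i\<in>I. x (\<pi> i))"
    by (intro distr_cong) (auto simp: extensional_comp_permutes[OF assms] space_cube PiE_def)
  also have "\<dots> = cube I"
    using assms by (intro distr_PiM_reindex)
      (auto simp: permutes_inj_on permutes_in_image)
  finally show ?thesis .
qed

lemma measurable_cube_permutes:
  assumes "\<pi> permutes I"
  shows "(\<lambda>x. x \<circ> \<pi>) \<in> measurable (cube I) (cube I)"
proof -
  have "(\<lambda>x. \<lambda>i\<in>I. x (\<pi> i)) \<in> measurable (cube I) (cube I)"
    using assms by (intro measurable_restrict measurable_component_singleton)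
      (auto simp: permutes_in_image)
  then show ?thesis
    by (rule measurable_cong[THEN iffD1, rotated])
       (auto simp: extensional_comp_permutes[OF assms] space_cube PiE_def)
qed

lemma integral_cube_permutes:
  fixes f :: "('i \<Rightarrow> real) \<Rightarrow> real"
  assumes "\<pi> permutes I" "f \<in> borel_measurable (cube I)"
  shows "(\<integral>x. f (x \<circ> \<pi>) \<partial>cube I) = (\<integral>x. f x \<partial>cube I)"
  by (subst (2) distr_cube_permutes[OF assms(1), symmetric])
     (simp add: integral_distr[OF measurable_cube_permutes[OF assms(1)] assms(2)])

text \<open>Fubini with coordinate \<open>i\<close> innermost: once the others are fixed, the tie
  confines \<open>x i\<close> to the single point \<open>x j\<close>, a null set.\<close>

lemma AE_cube_neq:
  fixes i j :: 'i
  assumes "finite I" "i \<in> I" "j \<in> I" "i \<noteq> j"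
  shows "AE x in cube I. x i \<noteq> x j"
proof -
  define J where "J = I - {i}"
  have I: "I = insert i J" "finite J" "i \<notin> J" "j \<in> J"
    using assms by (auto simp: J_def)
  define N where "N = {x \<in> space (cube I). x i = x j}"
  have N[measurable]: "N \<in> sets (cube I)"
    using assms unfolding N_def by measurable
  have "emeasure (cube I) N = (\<integral>\<^sup>+x. indicator N x \<partial>cube I)"
    by simp
  also have "\<dots> = (\<integral>\<^sup>+x. (\<integral>\<^sup>+t. indicator N (x(i := t)) \<partial>unit_measure) \<partial>cube J)"
    using I N unfolding I(1) by (intro cube.product_nn_integral_insert) auto
  also have "\<dots> = (\<integral>\<^sup>+x. 0 \<partial>cube J)"
  proof (intro nn_integral_cong)
    fix x :: "'i \<Rightarrow> real" assume x: "x \<in> space (cube J)"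
    have xj: "x j \<in> {0..1}" using cube_component_bounds[OF x \<open>j \<in> J\<close>] by simp
    have "(\<integral>\<^sup>+t. indicator N (x(i := t)) \<partial>unit_measure) \<le> (\<integral>\<^sup>+t. indicator {x j} t \<partial>unit_measure)"
      using assms by (intro nn_integral_mono) (auto simp: N_def indicator_def)
    also have "\<dots> = emeasure unit_measure {x j}"
      using xj by (intro nn_integral_indicator sets_unit_measure) auto
    also have "\<dots> = 0" using xj by (subst emeasure_unit_measure) auto
    finally show "(\<integral>\<^sup>+t. indicator N (x(i := t)) \<partial>unit_measure) = 0" by simp
  qed
  finally have "emeasure (cube I) N = 0" by simp
  then have "N \<in> null_sets (cube I)" using N by (simp add: null_sets_def)
  then show ?thesis
    by (rule AE_I') (auto simp: N_def)
qed

lemma AE_cube_inj_on: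
  assumes "finite I"
  shows "AE x in cube I. inj_on x I"
proof -
  have "AE x in cube I. \<forall>i\<in>I. \<forall>j\<in>I - {i}. x i \<noteq> x j"
    using assms AE_cube_neq[OF assms] by (auto simp: AE_finite_all)
  then show ?thesis
    by eventually_elim (auto simp: inj_on_def)
qed

section \<open>The Selberg integral\<close>

text \<open>The Selberg integrand with A = a - 1 and B = b - 1. The second product runs over ordered
  pairs, so each unordered pair gets total exponent 2c; this needs no order on the index type and
  makes the symmetry evident.\<close>

definition selberg_weight :: "'i set \<Rightarrow> nat \<Rightarrow> nat \<Rightarrow> nat \<Rightarrow> ('i \<Rightarrow> real) \<Rightarrow> real" where
  "selberg_weight I A B c x =
     (\<Prod>i\<in>I. x i ^ A * (1 - x i) ^ B) * (\<Prod>i\<in>I. \<Prod>j\<in>I - {i}. \<bar>x i - x j\<bar> ^ c)"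

lemma selberg_weight_measurable [measurable]:
  "selberg_weight I A B c \<in> borel_measurable (cube I)"
  unfolding selberg_weight_def by measurable

lemma selberg_weight_permutes:
  assumes "\<pi> permutes I"
  shows "selberg_weight I A B c (x \<circ> \<pi>) = selberg_weight I A B c x"
proof -
  have "(\<Prod>j\<in>I - {i}. \<bar>x (\<pi> i) - x (\<pi> j)\<bar> ^ c) = (\<Prod>j\<in>I - {\<pi> i}. \<bar>x (\<pi> i) - x j\<bar> ^ c)"
    if "i \<in> I" for i
  proof (rule prod.reindex_bij_betw)
    show "bij_betw \<pi> (I - {i}) (I - {\<pi> i})"
      using assms that permutes_imp_bij[OF assms]
      by (intro bij_betw_DiffI) (auto simp: bij_betw_def)
  qed
  then have "(\<Prod>i\<in>I. \<Prod>j\<in>I - {i}. \<bar>x (\<pi> i) - x (\<pi> j)\<bar> ^ c)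
      = (\<Prod>i\<in>I. \<Prod>j\<in>I - {\<pi> i}. \<bar>x (\<pi> i) - x j\<bar> ^ c)"
    by simp
  also have "\<dots> = (\<Prod>i\<in>I. \<Prod>j\<in>I - {i}. \<bar>x i - x j\<bar> ^ c)"
    by (rule prod.reindex_bij_betw[OF permutes_imp_bij[OF assms]])
  finally show ?thesis
    using prod.reindex_bij_betw[OF permutes_imp_bij[OF assms], of "\<lambda>i. x i ^ A * (1 - x i) ^ B"]
    by (simp add: selberg_weight_def)
qed

text \<open>Both orders of a pair with \<open>i\<close> combine to an even power, so the absolute
  values disappear: as a function of \<open>x i\<close> alone the weight is a polynomial and can be
  differentiated.\<close>

lemma selberg_weight_insert:
  assumes "finite J" "i \<notin> J"
  shows "selberg_weight (insert i J) A B c x =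
    x i ^ A * (1 - x i) ^ B * (\<Prod>j\<in>J. (x i - x j) ^ (2 * c)) * selberg_weight J A B c x"
proof -
  have *: "(\<Prod>k\<in>insert i J - {j}. \<bar>x j - x k\<bar> ^ c) = \<bar>x i - x j\<bar> ^ c * (\<Prod>k\<in>J - {j}. \<bar>x j - x k\<bar> ^ c)"
    if "j \<in> J" for j
  proof -
    have "insert i J - {j} = insert i (J - {j})" using that assms by auto
    then show ?thesis using assms by (simp add: abs_minus_commute)
  qed
  have sq: "(x i - x j) ^ (2 * c) = \<bar>x i - x j\<bar> ^ c * \<bar>x i - x j\<bar> ^ c" for j
    by (simp add: power_mult flip: power_add mult_2)
  have "insert i J - {i} = J" using assms by auto
  then show ?thesis
    using assms by (simp add: selberg_weight_def * sq prod.distrib)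
qed

lemma selberg_weight_upd:
  assumes "i \<notin> J"
  shows "selberg_weight J A B c (x(i := t)) = selberg_weight J A B c x"
proof -
  have "k \<noteq> i" if "k \<in> J" for k using that assms by auto
  then show ?thesis
    by (simp add: selberg_weight_def cong: prod.cong_simp)
qed

lemma selberg_weight_bounds:
  assumes "finite I" "x \<in> space (cube I)"
  shows "0 \<le> selberg_weight I A B c x" "selberg_weight I A B c x \<le> 1"
proof -
  have b: "0 \<le> x i" "x i \<le> 1" if "i \<in> I" for i
    using cube_component_bounds[OF assms(2) that] by auto
  have d: "\<bar>x i - x j\<bar> \<le> 1" if "i \<in> I" "j \<in> I" for i j
    using b[OF that(1)] b[OF that(2)] by auto
  show "0 \<le> selberg_weight I A B c x"
    using b unfolding selberg_weight_def by (intro mult_nonneg_nonneg prod_nonneg) auto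
  show "selberg_weight I A B c x \<le> 1"
    using b d unfolding selberg_weight_def
    by (intro mult_le_one prod_le_1 prod_nonneg conjI mult_nonneg_nonneg power_le_one) auto
qed

text \<open>The factor (x_i - x_j)^(2c) absorbs the pole and leaves the power 2c - 1; all remaining
  factors lie in [-1, 1]. This is the source of integrability for the cross terms.\<close>

lemma selberg_weight_divide_le:
  assumes "finite I" "x \<in> space (cube I)" "i \<in> I" "j \<in> I" "i \<noteq> j" "c \<ge> 1"
  shows "\<bar>selberg_weight I A B c x / (x i - x j)\<bar> \<le> 1"
proof -
  define J where "J = I - {i}"
  have I: "I = insert i J" "finite J" "i \<notin> J" "j \<in> J" "finite (J - {j})"
    using assms by (auto simp: J_def)
  have b: "0 \<le> x k" "x k \<le> 1" if "k \<in> I" for k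
    using cube_component_bounds[OF assms(2) that] by auto
  have d: "\<bar>x k - x l\<bar> \<le> 1" if "k \<in> I" "l \<in> I" for k l
    using b[OF that(1)] b[OF that(2)] by auto
  \<comment> \<open>Points of the smaller cube are extensional on \<open>J\<close>, so
    \<open>x\<close> is restricted before the bound applies; the weight over \<open>J\<close> sees
    only coordinates in \<open>J\<close>.\<close>
  have "restrict x J \<in> space (cube J)" using b I by (auto simp: space_cube)
  then have "selberg_weight J A B c (restrict x J) \<in> {0..1}"
    using selberg_weight_bounds[OF I(2)] by auto
  moreover have "selberg_weight J A B c (restrict x J) = selberg_weight J A B c x"
    by (simp add: selberg_weight_def cong: prod.cong_simp)
  ultimately have w: "\<bar>selberg_weight J A B c x\<bar> \<le> 1" by simp
  have "selberg_weight I A B c x / (x i - x j) = x i ^ A * (1 - x i) ^ B *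
     (((x i - x j) ^ (2 * c) / (x i - x j)) * (\<Prod>k\<in>J - {j}. (x i - x k) ^ (2 * c))) * selberg_weight J A B c x"
    unfolding I(1) selberg_weight_insert[OF I(2,3)]
    using prod.remove[OF I(2,4), of "\<lambda>k. (x i - x k) ^ (2 * c)"] by simp
  also have "(x i - x j) ^ (2 * c) / (x i - x j) = (x i - x j) ^ (2 * c - 1)"
    using assms(6) by (cases c) auto
  also have "\<bar>x i ^ A * (1 - x i) ^ B *
     ((x i - x j) ^ (2 * c - 1) * (\<Prod>k\<in>J - {j}. (x i - x k) ^ (2 * c))) * selberg_weight J A B c x\<bar> \<le> 1"
    unfolding abs_mult abs_prod power_abs
    using b[OF assms(3)] I
    by (intro mult_le_one prod_le_1 conjI w power_le_one mult_nonneg_nonneg prod_nonneg) (auto intro!: d)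
  finally show ?thesis .
qed

section \<open>Integration by parts in one coordinate, and antisymmetrization\<close>

lemma DERIV_prod_diff_power:
  fixes x :: "'i \<Rightarrow> real"
  assumes "finite J"
  shows "((\<lambda>t. \<Prod>j\<in>J. (t - x j) ^ m) has_real_derivative
    (\<Sum>j\<in>J. real m * (t - x j) ^ (m - 1) * (\<Prod>k\<in>J - {j}. (t - x k) ^ m))) (at t)"
  using assms
proof (induction J rule: finite_induct)
  case (insert i J)
  have D: "((\<lambda>t. (t - x i) ^ m) has_real_derivative real m * (t - x i) ^ (m - 1)) (at t)"
    by (auto intro!: derivative_eq_intros)
  have e: "(\<Prod>k\<in>insert i J - {j}. (t - x k) ^ m) = (t - x i) ^ m * (\<Prod>k\<in>J - {j}. (t - x k) ^ m)"
    if "j \<in> J" for j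
  proof -
    have "insert i J - {j} = insert i (J - {j})" using that insert.hyps by auto
    then show ?thesis using insert.hyps by simp
  qed
  have "insert i J - {i} = J" using insert.hyps by auto
  then show ?case
    using DERIV_mult[OF D insert.IH] insert.hyps
    by (simp add: e sum_distrib_left sum_distrib_right mult_ac add_ac)
qed simp

text \<open>The fundamental theorem of calculus in coordinate \<open>i\<close> for U(x_i) times the
  product of (x_i - x_j)^(2c). \<open>h\<close> and the weight of the other variables are constant
  there. The derivative of each power gives 2c / (x_i - x_j), and writing \<open>U\<close> as
  \<open>v\<close> times the one-variable weight restores the full weight in these terms.\<close>

lemma selberg_by_parts:
  fixes h :: "('i \<Rightarrow> real) \<Rightarrow> real" and U u v :: "real \<Rightarrow> real"
  assumes I: "finite I" "i \<in> I" and c: "c \<ge> 1"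
    and U: "\<And>t. (U has_real_derivative u t * (t ^ A * (1 - t) ^ B)) (at t)"
      "\<And>t. U t = v t * (t ^ A * (1 - t) ^ B)"
    and uv: "continuous_on UNIV u" "continuous_on UNIV v"
    and h [measurable]: "h \<in> borel_measurable (cube I)"
    and hb: "\<And>x. x \<in> space (cube I) \<Longrightarrow> \<bar>h x\<bar> \<le> 1"
    and hu: "\<And>x t. h (x(i := t)) = h x"
  shows "(\<integral>x. u (x i) * h x * selberg_weight I A B c x \<partial>cube I) +
      2 * real c * (\<Sum>j\<in>I - {i}. \<integral>x. v (x i) * h x * selberg_weight I A B c x / (x i - x j) \<partial>cube I) =
     (\<integral>x. h x * selberg_weight (I - {i}) A B c x *
        (U 1 * (\<Prod>j\<in>I - {i}. (1 - x j) ^ (2 * c)) - U 0 * (\<Prod>j\<in>I - {i}. x j ^ (2 * c))) \<partial>cube (I - {i}))"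
proof -
  define J where "J = I - {i}"
  have J: "I = insert i J" "finite J" "i \<notin> J"
    using I by (auto simp: J_def)
  let ?w = "selberg_weight I A B c" and ?M = "cube I"
  have [measurable]: "u \<in> borel_measurable borel" "v \<in> borel_measurable borel"
    using uv by (auto intro: borel_measurable_continuous_onI)
  have bnd: "\<exists>C. \<forall>t\<in>{0..1}. \<bar>g t\<bar> \<le> C" if "continuous_on UNIV g" for g :: "real \<Rightarrow> real"
  proof -
    have "compact (g ` {0..1})"
      using that by (intro compact_continuous_image) (auto intro: continuous_on_subset)
    then have "bounded (g ` {0..1})" by (rule compact_imp_bounded)
    then show ?thesis by (auto simp: bounded_iff)
  qed
  obtain Cu where Cu: "\<bar>u t\<bar> \<le> Cu" if "t \<in> {0..1}" for t using bnd[OF uv(1)] by blast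
  obtain Cv where Cv: "\<bar>v t\<bar> \<le> Cv" if "t \<in> {0..1}" for t using bnd[OF uv(2)] by blast
  have Cv0: "Cv \<ge> 0" using Cv[of 0] by auto
  have Cu0: "Cu \<ge> 0" using Cu[of 0] by auto
  have iu: "integrable ?M (\<lambda>x. u (x i) * h x * ?w x)"
  proof (rule integrable_cube_bounded[where C = "Cu * 1 * 1"])
    fix x assume x: "x \<in> space ?M"
    show "\<bar>u (x i) * h x * ?w x\<bar> \<le> Cu * 1 * 1"
      unfolding abs_mult using selberg_weight_bounds[OF I(1) x, of A B c] hb[OF x] Cu0
        cube_component_bounds[OF x I(2)]
      by (intro mult_mono Cu) auto
  qed (use I in measurable)
  have iv: "integrable ?M (\<lambda>x. v (x i) * h x * ?w x / (x i - x j))" if j: "j \<in> J" for j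
  proof (rule integrable_cube_bounded[where C = "Cv * 1 * 1"])
    have jI: "j \<in> I" "i \<noteq> j" using j J by auto
    show "(\<lambda>x. v (x i) * h x * ?w x / (x i - x j)) \<in> borel_measurable (cube I)"
      using I jI by measurable
    fix x assume x: "x \<in> space ?M"
    have "\<bar>v (x i) * h x * (?w x / (x i - x j))\<bar> \<le> Cv * 1 * 1"
      unfolding abs_mult using selberg_weight_divide_le[OF I(1) x I(2) jI(1,2) c, of A B] hb[OF x] Cv0
        cube_component_bounds[OF x I(2)]
      by (intro mult_mono Cv) auto
    then show "\<bar>v (x i) * h x * ?w x / (x i - x j)\<bar> \<le> Cv * 1 * 1" by simp
  qed
  let ?D = "\<lambda>x. u (x i) * h x * ?w x + (\<Sum>j\<in>J. 2 * real c * (v (x i) * h x * ?w x / (x i - x j)))"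
  have iv': "integrable ?M (\<lambda>x. 2 * real c * (v (x i) * h x * ?w x / (x i - x j)))" if "j \<in> J" for j
    using iv[OF that] by (rule integrable_mult_right)
  have isum: "integrable ?M (\<lambda>x. \<Sum>j\<in>J. 2 * real c * (v (x i) * h x * ?w x / (x i - x j)))"
    using iv' by (rule Bochner_Integration.integrable_sum)
  have iD: "integrable ?M ?D"
    using iu isum by (rule Bochner_Integration.integrable_add)
  have "(\<integral>x. u (x i) * h x * ?w x \<partial>?M) +
      2 * real c * (\<Sum>j\<in>J. \<integral>x. v (x i) * h x * ?w x / (x i - x j) \<partial>?M) = (\<integral>x. ?D x \<partial>?M)"
    by (simp only: Bochner_Integration.integral_add[OF iu isum] Bochner_Integration.integral_sum[OF iv']
      sum_distrib_left integral_mult_right_zero)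
  also have "\<dots> = (\<integral>x. (\<integral>t. ?D (x(i := t)) \<partial>unit_measure) \<partial>cube J)"
    using iD J(2,3) unfolding J(1) by (intro cube.product_integral_insert) auto
  also have "\<dots> = (\<integral>x. h x * selberg_weight J A B c x *
        (U 1 * (\<Prod>j\<in>J. (1 - x j) ^ (2 * c)) - U 0 * (\<Prod>j\<in>J. x j ^ (2 * c))) \<partial>cube J)"
  proof (intro Bochner_Integration.integral_cong refl)
    fix x :: "'i \<Rightarrow> real"
    let ?k = "h x * selberg_weight J A B c x"
    let ?P = "\<lambda>t. \<Prod>j\<in>J. (t - x j) ^ (2 * c)"
    let ?P' = "\<lambda>t. \<Sum>j\<in>J. real (2 * c) * (t - x j) ^ (2 * c - 1) * (\<Prod>k\<in>J - {j}. (t - x k) ^ (2 * c))"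
    let ?f = "\<lambda>t. (u t * (t ^ A * (1 - t) ^ B) * ?P t + ?P' t * U t) * ?k"
    have J': "j \<noteq> i" if "j \<in> J" for j using that J by auto
    have "?D (x(i := t)) = ?f t" for t
    proof -
      have w: "?w (x(i := t)) = t ^ A * (1 - t) ^ B * ?P t * selberg_weight J A B c x"
        unfolding J(1) selberg_weight_insert[OF J(2,3)] selberg_weight_upd[OF J(3)]
        by (simp add: J' cong: prod.cong_simp)
      \<comment> \<open>Valid also at \<open>t = x j\<close>: division by zero gives 0 on the left,
        and on the right the exponent 2c - 1 is positive.\<close>
      have p: "?P t / (t - x j) = (t - x j) ^ (2 * c - 1) * (\<Prod>k\<in>J - {j}. (t - x k) ^ (2 * c))"
        if "j \<in> J" for j
      proof -
        have "(t - x j) ^ (2 * c) / (t - x j) = (t - x j) ^ (2 * c - 1)"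
          using c by (cases c) auto
        then show ?thesis
          using prod.remove[OF J(2) that, of "\<lambda>k. (t - x k) ^ (2 * c)"]
          by (metis times_divide_eq_left)
      qed
      have "(\<Sum>j\<in>J. 2 * real c * (v t * h x * ?w (x(i := t)) / (t - (x(i := t)) j))) =
        (\<Sum>j\<in>J. 2 * real c * (v t * (t ^ A * (1 - t) ^ B) * ?k * (?P t / (t - x j))))"
        by (intro sum.cong refl) (simp add: w J')
      also have "\<dots> = ?P' t * U t * ?k"
        unfolding U(2) sum_distrib_right by (intro sum.cong refl, simp only: p, simp add: mult_ac)
      finally show ?thesis
        by (simp add: hu w algebra_simps)
    qed
    then have "(\<integral>t. ?D (x(i := t)) \<partial>unit_measure) = (\<integral>t. ?f t \<partial>unit_measure)"
      by simp
    also have "\<dots> = U 1 * ?P 1 * ?k - U 0 * ?P 0 * ?k"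
    proof (rule integral_unit_measure_FTC)
      show "((\<lambda>t. U t * ?P t * ?k) has_real_derivative ?f t) (at t)" for t
        using DERIV_cmult_right[OF DERIV_mult[OF U(1) DERIV_prod_diff_power[OF J(2), of x "2 * c"]], of ?k]
        by simp
      have "continuous_on UNIV U"
        using U(1) by (meson DERIV_continuous continuous_at_imp_continuous_on)
      then show "continuous_on UNIV ?f"
        using uv by (intro continuous_intros) auto
    qed
    finally show "(\<integral>t. ?D (x(i := t)) \<partial>unit_measure) = ?k *
        (U 1 * (\<Prod>j\<in>J. (1 - x j) ^ (2 * c)) - U 0 * (\<Prod>j\<in>J. x j ^ (2 * c)))"
      by (simp add: algebra_simps)
  qed
  finally show ?thesis by (simp add: J_def)
qed

text \<open>Average the integrand with its image under the swap of \<open>i\<close> and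
  \<open>j\<close>. The weight is invariant and the denominator changes sign, so the numerator
  becomes a difference divisible by x_i - x_j, with quotient \<open>\<psi>\<close>.\<close>

lemma selberg_antisymmetrize:
  fixes \<phi> \<psi> :: "('i \<Rightarrow> real) \<Rightarrow> real"
  assumes I: "finite I" "i \<in> I" "j \<in> I" "i \<noteq> j" and c: "c \<ge> 1"
    and \<phi> [measurable]: "\<phi> \<in> borel_measurable (cube I)"
    and b: "\<And>x. x \<in> space (cube I) \<Longrightarrow> \<bar>\<phi> x\<bar> \<le> 1"
    and \<psi>: "\<And>x. \<phi> x - \<phi> (x \<circ> Transposition.transpose i j) = (x i - x j) * \<psi> x"
  shows "2 * (\<integral>x. \<phi> x * selberg_weight I A B c x / (x i - x j) \<partial>cube I) =
    (\<integral>x. \<psi> x * selberg_weight I A B c x \<partial>cube I)"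
proof -
  let ?w = "selberg_weight I A B c" and ?\<tau> = "Transposition.transpose i j"
  have \<tau>: "?\<tau> permutes I" using I by (simp add: permutes_swap_id)
  let ?f = "\<lambda>x. \<phi> x * ?w x / (x i - x j)"
  have f [measurable]: "?f \<in> borel_measurable (cube I)"
    using I by measurable
  have "\<bar>?f x\<bar> \<le> 1" if x: "x \<in> space (cube I)" for x
  proof -
    have "\<bar>\<phi> x\<bar> * \<bar>?w x / (x i - x j)\<bar> \<le> 1 * 1"
      using b[OF x] selberg_weight_divide_le[OF I(1) x I(2-4) c, of A B] by (intro mult_mono) auto
    then show ?thesis by (simp add: abs_mult)
  qed
  then have int: "integrable (cube I) ?f"
    using f by (intro integrable_cube_bounded[where C = 1])
  have int': "integrable (cube I) (\<lambda>x. ?f (x \<circ> ?\<tau>))"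
    by (rule integrable_distr[OF measurable_cube_permutes[OF \<tau>]])
       (use int in \<open>simp add: distr_cube_permutes[OF \<tau>]\<close>)
  \<comment> \<open>On the diagonal the quotients are 0 by convention, so the right-hand side has to
    vanish as well; it does because the weight is 0 there.\<close>
  have w0: "?w x = 0" if "x i = x j" for x
  proof -
    have "I = insert i (I - {i})" "j \<in> I - {i}" using I by auto
    then show ?thesis
      using selberg_weight_insert[of "I - {i}" i A B c x] that I c by auto
  qed
  have "2 * (\<integral>x. ?f x \<partial>cube I) = (\<integral>x. ?f x \<partial>cube I) + (\<integral>x. ?f (x \<circ> ?\<tau>) \<partial>cube I)"
    using integral_cube_permutes[OF \<tau> f] by simp
  also have "\<dots> = (\<integral>x. ?f x + ?f (x \<circ> ?\<tau>) \<partial>cube I)"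
    by (rule Bochner_Integration.integral_add[OF int int', symmetric])
  also have "\<dots> = (\<integral>x. \<psi> x * ?w x \<partial>cube I)"
  proof (intro Bochner_Integration.integral_cong refl)
    fix x :: "'i \<Rightarrow> real"
    have "?f x + ?f (x \<circ> ?\<tau>) = (\<phi> x - \<phi> (x \<circ> ?\<tau>)) * ?w x / (x i - x j)"
      using minus_divide_right[of "\<phi> (x \<circ> ?\<tau>) * ?w x" "x i - x j"]
      by (simp add: selberg_weight_permutes[OF \<tau>] left_diff_distrib diff_divide_distrib)
    then show "?f x + ?f (x \<circ> ?\<tau>) = \<psi> x * ?w x"
      using w0[of x] unfolding \<psi> by (cases "x i = x j") auto
  qed
  finally show ?thesis .
qed

section \<open>Aomoto's moments and the recursions for the integral\<close>

text \<open>These interpolate between exponent A (at \<open>K = {}\<close>) and exponent A + 1 (at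
  \<open>K = I\<close>).\<close>

definition selberg_moment :: "'i set \<Rightarrow> nat \<Rightarrow> nat \<Rightarrow> nat \<Rightarrow> 'i set \<Rightarrow> real" where
  "selberg_moment I A B c K = (\<integral>x. (\<Prod>k\<in>K. x k) * selberg_weight I A B c x \<partial>cube I)"

lemma prod_components_bounds:
  assumes "x \<in> space (cube I)" "K \<subseteq> I"
  shows "0 \<le> (\<Prod>k\<in>K. x k)" "(\<Prod>k\<in>K. x k) \<le> 1"
  using cube_component_bounds[OF assms(1)] assms(2)
  by (auto intro!: prod_nonneg prod_le_1)

lemma integrable_selberg_moment:
  assumes "finite I" "K \<subseteq> I"
  shows "integrable (cube I) (\<lambda>x. (\<Prod>k\<in>K. x k) * selberg_weight I A B c x)"
proof (rule integrable_cube_bounded[where C = 1])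
  show "(\<lambda>x. (\<Prod>k\<in>K. x k) * selberg_weight I A B c x) \<in> borel_measurable (cube I)"
    by (measurable, use assms in auto)
  fix x assume x: "x \<in> space (cube I)"
  show "\<bar>(\<Prod>k\<in>K. x k) * selberg_weight I A B c x\<bar> \<le> 1"
    unfolding abs_mult
    using prod_components_bounds[OF x assms(2)] selberg_weight_bounds[OF assms(1) x, of A B c]
    by (intro mult_le_one) auto
qed

text \<open>The swap of \<open>i\<close> and \<open>j\<close> preserves weight and measure. Hence
  linear terms in different variables, arising from antisymmetrization, all yield the same
  moment.\<close>

lemma selberg_moment_exchange:
  assumes "finite I" "insert i (insert j K) \<subseteq> I" "i \<notin> K" "j \<notin> K"
  shows "selberg_moment I A B c (insert j K) = selberg_moment I A B c (insert i K)"
proof -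
  have \<tau>: "Transposition.transpose i j permutes I" using assms(2) by (intro permutes_swap_id) auto
  have K: "finite K" using finite_subset[OF _ assms(1), of K] assms(2) by simp
  let ?f = "\<lambda>x. (\<Prod>k\<in>insert i K. x k) * selberg_weight I A B c x"
  have "?f (x \<circ> Transposition.transpose i j) = (\<Prod>k\<in>insert j K. x k) * selberg_weight I A B c x" for x
  proof -
    have "(\<Prod>k\<in>K. x (Transposition.transpose i j k)) = (\<Prod>k\<in>K. x k)"
      using assms by (intro prod.cong refl arg_cong[of _ _ x] Transposition.transpose_apply_other) auto
    then show ?thesis
      unfolding selberg_weight_permutes[OF \<tau>] using K assms by simp
  qed
  moreover have "?f \<in> borel_measurable (cube I)"
    using integrable_selberg_moment[OF assms(1), of "insert i K" A B c] assms(2) by auto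
  ultimately show ?thesis
    unfolding selberg_moment_def using integral_cube_permutes[OF \<tau>, of ?f] by simp
qed

text \<open>Aomoto's recursion: integrate \<open>\<partial>\<^sub>i (x\<^sub>i (1 - x\<^sub>i) \<Prod>k\<in>K. x\<^sub>k \<cdot> w)\<close>, whose boundary terms vanish,
  and antisymmetrize each cross term \<open>1 / (x\<^sub>i - x\<^sub>j)\<close>.\<close>

lemma selberg_moment_insert:
  assumes I: "finite I" "insert i K \<subseteq> I" "i \<notin> K" and c: "c \<ge> 1"
  shows "(real A + 1 + real c * real (card (I - insert i K))) * selberg_moment I A B c K =
    (real A + real B + 2 + real c * (2 * real (card (I - insert i K)) + real (card K))) *
      selberg_moment I A B c (insert i K)"
proof -
  let ?w = "selberg_weight I A B c" and ?M = "cube I" and ?e = "selberg_moment I A B c"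
  let ?h = "\<lambda>x :: 'a \<Rightarrow> real. \<Prod>k\<in>K. x k"
  \<comment> \<open>Both exponents are raised by one, so \<open>U\<close> vanishes at 0 and at 1;
    \<open>v\<close> and \<open>u\<close> are the cofactors of t^A (1 - t)^B in \<open>U\<close> and
    in its derivative.\<close>
  define U :: "real \<Rightarrow> real" where "U = (\<lambda>t. t ^ Suc A * (1 - t) ^ Suc B)"
  define v where "v t = t * (1 - t)" for t :: real
  define u where "u t = (real A + 1) * (1 - t) - (real B + 1) * t" for t :: real
  have K: "finite K" "K \<subseteq> I" using finite_subset[OF _ I(1), of K] I(2) by auto
  have iI: "i \<in> I" using I by auto
  have h [measurable]: "?h \<in> borel_measurable ?M"
    by (measurable, use K in auto)
  have eK: "(\<integral>x. ?h x * ?w x \<partial>?M) = ?e K" by (simp add: selberg_moment_def)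
  have eK': "(\<integral>x. x j * ?h x * ?w x \<partial>?M) = ?e (insert i K)" if "j \<in> I - K" for j
    using selberg_moment_exchange[OF I(1), of i j K A B c] that I K
    by (simp add: selberg_moment_def)
  have intK: "integrable ?M (\<lambda>x. ?h x * ?w x)"
    using integrable_selberg_moment[OF I(1) K(2)] .
  have intK': "integrable ?M (\<lambda>x. x j * ?h x * ?w x)" if "j \<in> I - K" for j
    using integrable_selberg_moment[OF I(1), of "insert j K" A B c] that K by simp
  have "(\<integral>x. u (x i) * ?h x * ?w x \<partial>?M) +
      2 * real c * (\<Sum>j\<in>I - {i}. \<integral>x. v (x i) * ?h x * ?w x / (x i - x j) \<partial>?M) =
     (\<integral>x. ?h x * selberg_weight (I - {i}) A B c x *
        (U 1 * (\<Prod>j\<in>I - {i}. (1 - x j) ^ (2 * c)) - U 0 * (\<Prod>j\<in>I - {i}. x j ^ (2 * c))) \<partial>cube (I - {i}))"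
  proof (rule selberg_by_parts[OF I(1) iI c])
    show "(U has_real_derivative u t * (t ^ A * (1 - t) ^ B)) (at t)" for t
    proof -
      have "((\<lambda>t. t ^ Suc A) has_real_derivative real (Suc A) * t ^ A) (at t)"
        "((\<lambda>t. (1 - t) ^ Suc B) has_real_derivative - (real (Suc B) * (1 - t) ^ B)) (at t)"
        by (auto intro!: derivative_eq_intros simp del: power_Suc)
      from DERIV_mult[OF this] show ?thesis
        unfolding U_def by (rule DERIV_cong) (simp add: u_def algebra_simps)
    qed
    show "\<bar>?h x\<bar> \<le> 1" if "x \<in> space ?M" for x
      using prod_components_bounds[OF that K(2)] by simp
    show "?h (x(i := t)) = ?h x" for x t
      using I(3) by (intro prod.cong) auto
  qed (auto simp: U_def v_def u_def intro!: continuous_intros)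
  also have "\<dots> = 0" by (simp add: U_def)
  finally have ibp: "(\<integral>x. u (x i) * ?h x * ?w x \<partial>?M) +
      2 * real c * (\<Sum>j\<in>I - {i}. \<integral>x. v (x i) * ?h x * ?w x / (x i - x j) \<partial>?M) = 0" .
  have first: "(\<integral>x. u (x i) * ?h x * ?w x \<partial>?M) =
      (real A + 1) * ?e K - (real A + real B + 2) * ?e (insert i K)"
  proof -
    have "(\<integral>x. u (x i) * ?h x * ?w x \<partial>?M) =
      (\<integral>x. (real A + 1) * (?h x * ?w x) - (real A + real B + 2) * (x i * ?h x * ?w x) \<partial>?M)"
      by (intro Bochner_Integration.integral_cong refl) (simp add: u_def algebra_simps)
    then show ?thesis
      using intK intK'[of i] iI I(3) by (simp add: eK eK'[of i])
  qed
  let ?T = "\<lambda>j. \<integral>x. v (x i) * ?h x * ?w x / (x i - x j) \<partial>?M"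
  have bnd: "\<bar>v (x i) * ?h x\<bar> \<le> 1" if x: "x \<in> space ?M" for x
    unfolding v_def abs_mult
    using prod_components_bounds[OF x K(2)] cube_component_bounds[OF x iI]
    by (intro mult_le_one) auto
  have mv [measurable]: "(\<lambda>x. v (x i) * ?h x) \<in> borel_measurable ?M"
    unfolding v_def using iI by measurable
  \<comment> \<open>Here \<open>?h\<close> is unchanged by the swap, and x_i (1 - x_i) - x_j (1 -
    x_j) = (x_i - x_j) (1 - x_i - x_j).\<close>
  have outer: "2 * ?T j = ?e K - 2 * ?e (insert i K)" if j: "j \<in> I - insert i K" for j
  proof -
    have ji: "j \<in> I" "i \<noteq> j" using j by auto
    have "2 * ?T j = (\<integral>x. (1 - x i - x j) * ?h x * ?w x \<partial>?M)"
    proof (rule selberg_antisymmetrize[OF I(1) iI ji c mv bnd])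
      fix x :: "'a \<Rightarrow> real"
      have "?h (x \<circ> Transposition.transpose i j) = ?h x"
        using I(3) j by (intro prod.cong refl) (auto simp: Transposition.transpose_def)
      then show "v (x i) * ?h x - v ((x \<circ> Transposition.transpose i j) i) * ?h (x \<circ> Transposition.transpose i j) =
        (x i - x j) * ((1 - x i - x j) * ?h x)"
        by (simp add: v_def algebra_simps)
    qed
    also have "\<dots> = (\<integral>x. ?h x * ?w x - x i * ?h x * ?w x - x j * ?h x * ?w x \<partial>?M)"
      by (intro Bochner_Integration.integral_cong refl) (simp add: algebra_simps)
    also have "\<dots> = ?e K - 2 * ?e (insert i K)"
      using intK intK'[of i] intK'[of j] j iI I(3) by (simp add: eK eK'[of i] eK'[of j])
    finally show ?thesis .
  qed
  \<comment> \<open>Now \<open>?h\<close> contains x_j and the swap turns that factor into x_i: x_i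
    (1 - x_i) x_j - x_j (1 - x_j) x_i = -(x_i - x_j) x_i x_j.\<close>
  have inner: "2 * ?T j = - ?e (insert i K)" if j: "j \<in> K" for j
  proof -
    have ji: "j \<in> I" "i \<noteq> j" using j I by auto
    have "2 * ?T j = (\<integral>x. (- (x i * ?h x)) * ?w x \<partial>?M)"
    proof (rule selberg_antisymmetrize[OF I(1) iI ji c mv bnd])
      fix x :: "'a \<Rightarrow> real"
      let ?g = "\<Prod>k\<in>K - {j}. x k"
      have "(\<Prod>k\<in>K - {j}. (x \<circ> Transposition.transpose i j) k) = ?g"
        using I(3) j by (intro prod.cong refl) (auto simp: Transposition.transpose_def)
      then have "?h (x \<circ> Transposition.transpose i j) = x i * ?g" "?h x = x j * ?g"
        using prod.remove[OF K(1) j, of x] prod.remove[OF K(1) j, of "x \<circ> Transposition.transpose i j"]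
        by simp_all
      then show "v (x i) * ?h x - v ((x \<circ> Transposition.transpose i j) i) * ?h (x \<circ> Transposition.transpose i j) =
        (x i - x j) * (- (x i * ?h x))"
        by (simp add: v_def algebra_simps)
    qed
    also have "\<dots> = - ?e (insert i K)"
      using eK'[of i] iI I(3) by simp
    finally show ?thesis .
  qed
  have split: "I - {i} = (I - insert i K) \<union> K" "(I - insert i K) \<inter> K = {}"
    using I by auto
  have "2 * (\<Sum>j\<in>I - {i}. ?T j) = (\<Sum>j\<in>I - insert i K. 2 * ?T j) + (\<Sum>j\<in>K. 2 * ?T j)"
    unfolding split(1) using I(1) K(1) split(2)
    by (subst sum.union_disjoint) (auto simp: sum_distrib_left)
  also have "\<dots> = real (card (I - insert i K)) * (?e K - 2 * ?e (insert i K)) - real (card K) * ?e (insert i K)"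
    by (simp add: outer inner)
  finally have "real c * (2 * (\<Sum>j\<in>I - {i}. ?T j)) = real c *
    (real (card (I - insert i K)) * (?e K - 2 * ?e (insert i K)) - real (card K) * ?e (insert i K))"
    by simp
  then show ?thesis
    using ibp first by (simp add: algebra_simps)
qed

definition selberg_integral :: "'i set \<Rightarrow> nat \<Rightarrow> nat \<Rightarrow> nat \<Rightarrow> real" where
  "selberg_integral I A B c = (\<integral>x. selberg_weight I A B c x \<partial>cube I)"

lemma selberg_moment_empty: "selberg_moment I A B c {} = selberg_integral I A B c"
  by (simp add: selberg_moment_def selberg_integral_def)

lemma selberg_moment_full: "selberg_moment I A B c I = selberg_integral I (Suc A) B c"
  unfolding selberg_moment_def selberg_integral_def
  by (intro Bochner_Integration.integral_cong refl)
     (simp add: selberg_weight_def prod.distrib mult_ac)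

text \<open>Chains the moment recursion from \<open>{}\<close> up to \<open>I\<close>. Both sides
  are kept as products, so nothing has to be divided out along the way.\<close>

lemma selberg_integral_Suc:
  assumes I: "finite I" and c: "c \<ge> 1"
  defines "n \<equiv> card I"
  shows "selberg_integral I (Suc A) B c * (\<Prod>j<n. real (A + B + 2 + c * (n - 1 + j))) =
    selberg_integral I A B c * (\<Prod>j<n. real (A + 1 + c * j))"
proof -
  let ?p = "\<lambda>j. real (A + B + 2 + c * (n - 1 + j))" and ?q = "\<lambda>j. real (A + 1 + c * j)"
  have "selberg_moment I A B c K * (\<Prod>m<card K. ?p (n - Suc m)) =
    selberg_integral I A B c * (\<Prod>m<card K. ?q (n - Suc m))" if "finite K" "K \<subseteq> I" for K
    using that
  proof (induction K rule: finite_induct)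
    case empty
    then show ?case by (simp add: selberg_moment_empty)
  next
    case (insert i K)
    have "card (insert i K) \<le> n"
      using card_mono[OF I insert.prems] by (simp add: n_def)
    then have k: "card K < n" using insert.hyps by simp
    have card: "card (I - insert i K) = n - Suc (card K)"
      using insert.hyps insert.prems by (simp add: card_Diff_subset n_def)
    \<comment> \<open>With k = card K the coefficient of c is 2 (n - 1 - k) + k = (n - 1) + (n - 1 -
      k). The factors therefore appear in descending order of j and are reversed at the end.\<close>
    have p: "real A + real B + 2 + real c * (2 * real (n - Suc (card K)) + real (card K)) = ?p (n - Suc (card K))"
    proof -
      obtain m where "n = Suc (card K + m)" using less_imp_Suc_add[OF k] by auto
      then show ?thesis by (simp add: algebra_simps)
    qed
    have q: "real A + 1 + real c * real (n - Suc (card K)) = ?q (n - Suc (card K))"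
      by simp
    have step: "?q (n - Suc (card K)) * selberg_moment I A B c K =
      ?p (n - Suc (card K)) * selberg_moment I A B c (insert i K)"
      using selberg_moment_insert[OF I insert.prems insert.hyps(2) c, of A B] unfolding card p q .
    have combine: "e' * (s * p) = z * (t * q)" if "q * e = p * e'" "e * s = z * t"
      for e e' p q s t z :: real
      using that by algebra
    show ?case
      unfolding card_insert_disjoint[OF insert.hyps] prod.lessThan_Suc
      by (rule combine[OF step insert.IH]) (use insert.prems in auto)
  qed
  from this[OF I order_refl] show ?thesis
    using prod.nat_diff_reindex[of ?p n] prod.nat_diff_reindex[of ?q n]
    by (simp add: selberg_moment_full n_def)
qed

text \<open>Integrate the derivative of (1 - x_i)^(B + 1), without a factor x_i. The boundary term
  at x_i = 0 survives, and there (x_i - x_j)^(2c) becomes x_j^(2c), which raises the exponent of the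
  remaining variables from 0 to 2c.\<close>

lemma selberg_integral_insert_0:
  fixes i :: 'i
  assumes J: "finite J" "i \<notin> J" and c: "c \<ge> 1"
  shows "real (B + 1 + c * card J) * selberg_integral (insert i J) 0 B c = selberg_integral J (2 * c) B c"
proof -
  let ?I = "insert i J"
  let ?w = "selberg_weight ?I 0 B c" and ?M = "cube ?I"
  have I: "finite ?I" "i \<in> ?I" using J by auto
  have diff: "?I - {i} = J" using J by auto
  have "(\<integral>x. - real (Suc B) * 1 * ?w x \<partial>?M) +
      2 * real c * (\<Sum>j\<in>?I - {i}. \<integral>x. (1 - x i) * 1 * ?w x / (x i - x j) \<partial>?M) =
     (\<integral>x. 1 * selberg_weight (?I - {i}) 0 B c x *
        ((1 - 1) ^ Suc B * (\<Prod>j\<in>?I - {i}. (1 - x j) ^ (2 * c))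
         - (1 - 0) ^ Suc B * (\<Prod>j\<in>?I - {i}. x j ^ (2 * c))) \<partial>cube (?I - {i}))"
  proof (rule selberg_by_parts[OF I c, where U = "\<lambda>t. (1 - t) ^ Suc B" and v = "\<lambda>t. 1 - t"
        and u = "\<lambda>t. - real (Suc B)"])
    show "((\<lambda>t. (1 - t) ^ Suc B) has_real_derivative - real (Suc B) * (t ^ 0 * (1 - t) ^ B)) (at t)" for t :: real
      by (auto intro!: derivative_eq_intros simp: algebra_simps simp del: power_Suc)
  qed (auto intro!: continuous_intros)
  moreover have "2 * (\<integral>x. (1 - x i) * ?w x / (x i - x j) \<partial>?M) = - selberg_integral ?I 0 B c"
    if j: "j \<in> J" for j
  proof -
    have ji: "j \<in> ?I" "i \<noteq> j" using j J by auto
    \<comment> \<open>(1 - x_i) - (1 - x_j) = -(x_i - x_j), so the antisymmetrized quotient is the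
      constant -1.\<close>
    have "2 * (\<integral>x. (1 - x i) * ?w x / (x i - x j) \<partial>?M) = (\<integral>x. (- 1) * ?w x \<partial>?M)"
    proof (rule selberg_antisymmetrize[OF I ji c])
      show "(\<lambda>x. 1 - x i) \<in> borel_measurable ?M" by measurable
      show "\<bar>1 - x i\<bar> \<le> 1" if "x \<in> space ?M" for x
        using cube_component_bounds[OF that I(2)] by simp
    qed simp
    then show ?thesis by (simp add: selberg_integral_def)
  qed
  then have "2 * (\<Sum>j\<in>J. \<integral>x. (1 - x i) * ?w x / (x i - x j) \<partial>?M) = - (real (card J) * selberg_integral ?I 0 B c)"
    by (simp add: sum_distrib_left)
  moreover have "(\<integral>x. selberg_weight J 0 B c x * (\<Prod>j\<in>J. x j ^ (2 * c)) \<partial>cube J) = selberg_integral J (2 * c) B c"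
    unfolding selberg_integral_def
    by (intro Bochner_Integration.integral_cong refl)
       (simp add: selberg_weight_def prod.distrib mult_ac)
  ultimately have "- real (Suc B) * selberg_integral ?I 0 B c +
      real c * (- (real (card J) * selberg_integral ?I 0 B c)) = - selberg_integral J (2 * c) B c"
    unfolding diff by (simp add: selberg_integral_def mult.assoc mult.left_commute[of 2])
  then show ?thesis by (simp add: algebra_simps)
qed

section \<open>The closed form and its agreement with the integral\<close>

text \<open>Selberg's gamma product at integer parameters. For c >= 1 the usual factor (c (j + 1))!
  / c! is written as (j + 1) (c + cj - 1)! / (c - 1)!, so that n! can be split off later.\<close>

definition selberg_product :: "nat \<Rightarrow> nat \<Rightarrow> nat \<Rightarrow> nat \<Rightarrow> real" where
  "selberg_product n A B c =
     (\<Prod>j<n. fact (A + c * j) * fact (B + c * j) * (real (j + 1) * fact (c + c * j - 1)) /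
        (fact (c - 1) * fact (A + B + 1 + c * (n - 1 + j))))"

text \<open>Holds factor by factor, each step being one use of (m + 1)! = (m + 1) m!. It is the
  relation that \<open>selberg_integral_Suc\<close> gives for the integral.\<close>

lemma selberg_product_Suc:
  "selberg_product n (Suc A) B c * (\<Prod>j<n. real (A + B + 2 + c * (n - 1 + j))) =
    selberg_product n A B c * (\<Prod>j<n. real (A + 1 + c * j))"
  unfolding selberg_product_def prod.distrib[symmetric]
proof (intro prod.cong refl)
  fix j
  have 1: "fact (Suc A + c * j) = real (A + 1 + c * j) * fact (A + c * j)" by simp
  have 2: "fact (Suc A + B + 1 + c * (n - 1 + j)) =
      real (A + B + 2 + c * (n - 1 + j)) * fact (A + B + 1 + c * (n - 1 + j))" by simp
  have 3: "real (A + B + 2 + c * (n - 1 + j)) \<noteq> 0" by (simp only: of_nat_eq_0_iff)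
  show "fact (Suc A + c * j) * fact (B + c * j) * (real (j + 1) * fact (c + c * j - 1)) /
        (fact (c - 1) * fact (Suc A + B + 1 + c * (n - 1 + j))) * real (A + B + 2 + c * (n - 1 + j)) =
     fact (A + c * j) * fact (B + c * j) * (real (j + 1) * fact (c + c * j - 1)) /
        (fact (c - 1) * fact (A + B + 1 + c * (n - 1 + j))) * real (A + 1 + c * j)"
    unfolding 1 2 using 3 by (simp only: times_divide_eq_left) (simp add: divide_simps)
qed

text \<open>The counterpart of \<open>selberg_integral_insert_0\<close>. Replacing exponent 0 in n +
  1 variables by 2c in n variables shifts the first numerator family by two indices and drops one
  denominator; the boundary factors balance.\<close>

lemma selberg_product_0:
  assumes c: "c \<ge> 1"
  shows "real (B + 1 + c * n) * selberg_product (Suc n) 0 B c = selberg_product n (2 * c) B c"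
proof -
  define f :: "nat \<Rightarrow> real" where "f j = fact (c * j)" for j
  define g :: "nat \<Rightarrow> real" where
    "g j = fact (B + c * j) * (real (j + 1) * fact (c + c * j - 1)) / fact (c - 1)" for j
  define d :: "nat \<Rightarrow> real" where "d j = fact (B + 1 + c * j)" for j
  have L: "selberg_product (Suc n) 0 B c = (\<Prod>j<Suc n. f j) * (\<Prod>j<Suc n. g j) / (\<Prod>j<Suc n. d (n + j))"
    unfolding selberg_product_def prod.distrib[symmetric] prod_dividef[symmetric]
    by (intro prod.cong) (simp_all add: f_def g_def d_def)
  have R: "selberg_product n (2 * c) B c = (\<Prod>j<n. f (j + 2)) * (\<Prod>j<n. g j) / (\<Prod>j<n. d (n + Suc j))"
    unfolding selberg_product_def prod.distrib[symmetric] prod_dividef[symmetric]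
  proof (intro prod.cong refl)
    fix j assume "j \<in> {..<n}"
    then have "2 * c + B + 1 + c * (n - 1 + j) = B + 1 + c * (n + Suc j)"
      by (cases n) (auto simp: algebra_simps)
    moreover have "2 * c + c * j = c * (j + 2)" by (simp add: algebra_simps)
    ultimately show "fact (2 * c + c * j) * fact (B + c * j) * (real (j + 1) * fact (c + c * j - 1)) /
        (fact (c - 1) * fact (2 * c + B + 1 + c * (n - 1 + j))) = f (j + 2) * g j / d (n + Suc j)"
      by (simp only: f_def g_def d_def) simp
  qed
  \<comment> \<open>The shift loses \<open>f 0 = 1\<close> and \<open>f 1 = fact c\<close> and gains
    \<open>f (Suc n)\<close>.\<close>
  have F: "(\<Prod>j<n. f (j + 2)) * fact c = (\<Prod>j<Suc n. f j) * f (Suc n)"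
  proof -
    have "(\<Prod>j<Suc (Suc n). f j) = f 0 * (f 1 * (\<Prod>j<n. f (j + 2)))"
      by (simp only: prod.lessThan_Suc_shift) simp
    then show ?thesis by (simp add: f_def mult_ac)
  qed
  have D: "(\<Prod>j<Suc n. d (n + j)) = d n * (\<Prod>j<n. d (n + Suc j))"
    by (subst prod.lessThan_Suc_shift) simp
  have dn: "d n = real (B + 1 + c * n) * fact (B + c * n)"
    unfolding d_def by simp
  have fn: "f (Suc n) = real c * real (n + 1) * fact (c + c * n - 1)"
  proof -
    have "c * Suc n = Suc (c + c * n - 1)" using c by simp
    then have "f (Suc n) = real (Suc (c + c * n - 1)) * fact (c + c * n - 1)"
      unfolding f_def by (simp only: fact_Suc of_nat_mult)
    also have "real (Suc (c + c * n - 1)) = real c * real (n + 1)"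
      using c by (simp add: algebra_simps)
    finally show ?thesis .
  qed
  have fc: "(fact c :: real) = real c * fact (c - 1)"
    using c by (cases c) auto
  \<comment> \<open>The dropped factor \<open>g n\<close> supplies exactly the gained
    \<open>f (Suc n)\<close> over \<open>fact c\<close>, and its (B + cn)! reduces
    \<open>d n\<close> to B + 1 + cn.\<close>
  have gn: "f (Suc n) * fact (B + c * n) = g n * fact c"
    unfolding g_def fn fc by simp
  have "real (B + 1 + c * n) * selberg_product (Suc n) 0 B c =
      real (B + 1 + c * n) * ((\<Prod>j<Suc n. f j) * ((\<Prod>j<n. g j) * g n) / (d n * (\<Prod>j<n. d (n + Suc j))))"
    unfolding L D by simp
  also have "\<dots> = (\<Prod>j<Suc n. f j) * g n * (\<Prod>j<n. g j) / (fact (B + c * n) * (\<Prod>j<n. d (n + Suc j)))"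
  proof -
    have "real (B + 1 + c * n) \<noteq> 0" by (simp only: of_nat_eq_0_iff)
    then show ?thesis unfolding dn by (simp only: mult_ac times_divide_eq_right mult_divide_mult_cancel_left)
      (simp add: divide_simps)
  qed
  also have "(\<Prod>j<Suc n. f j) * g n = (\<Prod>j<n. f (j + 2)) * fact (B + c * n)"
  proof -
    have "((\<Prod>j<Suc n. f j) * g n) * fact c = (\<Prod>j<Suc n. f j) * f (Suc n) * fact (B + c * n)"
      using gn by (simp only: mult.assoc)
    also have "\<dots> = ((\<Prod>j<n. f (j + 2)) * fact (B + c * n)) * fact c"
      unfolding F[symmetric] by (simp only: mult_ac)
    finally show ?thesis by simp
  qed
  also have "(\<Prod>j<n. f (j + 2)) * fact (B + c * n) * (\<Prod>j<n. g j) / (fact (B + c * n) * (\<Prod>j<n. d (n + Suc j)))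
    = selberg_product n (2 * c) B c"
    unfolding R by simp
  finally show ?thesis .
qed

theorem selberg_integral_eq:
  assumes "finite I" "c \<ge> 1"
  shows "selberg_integral I A B c = selberg_product (card I) A B c"
  using assms(1)
\<comment> \<open>\<open>A\<close> must be arbitrary: the inner base case A = 0 uses the hypothesis
  for \<open>J\<close> at exponent 2c.\<close>
proof (induction I arbitrary: A rule: finite_induct)
  case empty
  show ?case
    using prob_space.prob_space[OF prob_space_PiM[of "{}" "\<lambda>_. unit_measure"]] by (simp add: selberg_integral_def selberg_product_def selberg_weight_def)
next
  case (insert i J)
  show ?case
  proof (induction A)
    case 0
    have "real (B + 1 + c * card J) * selberg_integral (insert i J) 0 B c =
      real (B + 1 + c * card J) * selberg_product (card (insert i J)) 0 B c"
      using selberg_integral_insert_0[OF insert.hyps assms(2), of B] insert.IH[of "2 * c"]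
        selberg_product_0[OF assms(2), of B "card J"] insert.hyps by simp
    moreover have "real (B + 1 + c * card J) \<noteq> 0" by (simp only: of_nat_eq_0_iff)
    ultimately show ?case by (metis mult_cancel_left)
  next
    case (Suc A)
    let ?n = "card (insert i J)"
    let ?p = "\<Prod>j<?n. real (A + B + 2 + c * (?n - 1 + j))"
    have "selberg_integral (insert i J) (Suc A) B c * ?p = selberg_product ?n (Suc A) B c * ?p"
      using selberg_integral_Suc[OF _ assms(2), of "insert i J" A B] insert.hyps(1)
      unfolding selberg_product_Suc Suc.IH by simp
    moreover have "?p \<noteq> 0"
      by (subst prod_zero_iff) (simp_all only: of_nat_eq_0_iff finite_lessThan, simp)
    ultimately show ?case by (metis mult_cancel_right)
  qed
qed

section \<open>Rankings and symmetric integrands\<close>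

text \<open>Counting with \<open>\<le>\<close> makes ranks start at 1, as topological orderings do.
  The codomain is a general linear order because both real labels and orderings with values in
  \<open>nat\<close> get ranked.\<close>

definition rank_on :: "'i set \<Rightarrow> ('i \<Rightarrow> 'b::linorder) \<Rightarrow> 'i \<Rightarrow> nat" where
  "rank_on I x u = card {v \<in> I. x v \<le> x u}"

lemma rank_on_less_iff:
  assumes "finite I" "u \<in> I" "v \<in> I"
  shows "rank_on I x u < rank_on I x v \<longleftrightarrow> x u < x v"
proof
  assume "x u < x v"
  then have "{w \<in> I. x w \<le> x u} \<subseteq> {w \<in> I. x w \<le> x v}"
    "v \<in> {w \<in> I. x w \<le> x v}" "v \<notin> {w \<in> I. x w \<le> x u}"
    using assms by auto
  then have "{w \<in> I. x w \<le> x u} \<subset> {w \<in> I. x w \<le> x v}" by blast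
  then show "rank_on I x u < rank_on I x v"
    unfolding rank_on_def using assms(1) by (intro psubset_card_mono) auto
next
  assume *: "rank_on I x u < rank_on I x v"
  show "x u < x v"
  proof (rule ccontr)
    assume "\<not> x u < x v"
    then have "{w \<in> I. x w \<le> x v} \<subseteq> {w \<in> I. x w \<le> x u}"
      by auto
    then have "rank_on I x v \<le> rank_on I x u"
      unfolding rank_on_def using assms(1) by (intro card_mono) auto
    with * show False by simp
  qed
qed

lemma bij_betw_rank_on:
  assumes "finite I" "inj_on x I"
  shows "bij_betw (rank_on I x) I {1..card I}"
proof -
  have inj: "inj_on (rank_on I x) I"
  proof (rule inj_onI)
    fix u v assume uv: "u \<in> I" "v \<in> I" "rank_on I x u = rank_on I x v"
    then have "x u = x v"
      using rank_on_less_iff[OF assms(1) uv(1,2), of x] rank_on_less_iff[OF assms(1) uv(2,1), of x]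
      by (metis less_irrefl linorder_less_linear)
    then show "u = v" using assms(2) uv by (auto dest: inj_onD)
  qed
  have sub: "rank_on I x ` I \<subseteq> {1..card I}"
  proof safe
    fix u assume u: "u \<in> I"
    then have "{v \<in> I. x v \<le> x u} \<noteq> {}" by auto
    then have "rank_on I x u > 0"
      unfolding rank_on_def using assms(1) by (subst card_gt_0_iff) auto
    moreover have "rank_on I x u \<le> card I"
      unfolding rank_on_def using assms(1) by (intro card_mono) auto
    ultimately show "rank_on I x u \<in> {1..card I}" by auto
  qed
  then have "rank_on I x ` I = {1..card I}"
    using inj by (intro card_subset_eq) (auto simp: card_image)
  with inj show ?thesis by (simp add: bij_betw_def)
qed

lemma rank_on_cong:
  assumes "\<And>u v. u \<in> I \<Longrightarrow> v \<in> I \<Longrightarrow> x u < x v \<longleftrightarrow> y u < y v" "u \<in> I"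
  shows "rank_on I x u = rank_on I y u"
proof -
  have "{v \<in> I. x v \<le> x u} = {v \<in> I. y v \<le> y u}"
    using assms by (auto simp: not_less[symmetric])
  then show ?thesis by (simp add: rank_on_def)
qed

lemma rank_on_bij_betw:
  assumes "bij_betw f I {1..card I}" "u \<in> I"
  shows "rank_on I f u = f u"
proof -
  have "f ` {v \<in> I. f v \<le> f u} = {1..f u}"
  proof
    show "{1..f u} \<subseteq> f ` {v \<in> I. f v \<le> f u}"
    proof
      fix k assume k: "k \<in> {1..f u}"
      have "f u \<le> card I" using assms by (auto simp: bij_betw_def)
      then have "k \<in> f ` I" using assms k by (auto simp: bij_betw_def)
      then show "k \<in> f ` {v \<in> I. f v \<le> f u}" using k by auto
    qed
  next
    show "f ` {v \<in> I. f v \<le> f u} \<subseteq> {1..f u}"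
      using assms(1) by (auto simp: bij_betw_def)
  qed
  moreover have "inj_on f {v \<in> I. f v \<le> f u}"
    using assms(1) by (auto simp: bij_betw_def intro: inj_on_subset)
  ultimately have "card {v \<in> I. f v \<le> f u} = card {1..f u}"
    by (metis card_image)
  then show ?thesis by (simp add: rank_on_def)
qed

lemma rank_on_comp_permutes:
  assumes "\<pi> permutes I"
  shows "rank_on I (x \<circ> \<pi>) u = rank_on I x (\<pi> u)"
proof -
  have "\<pi> ` I = I" using assms by (rule permutes_image)
  then have "{v \<in> I. x v \<le> x (\<pi> u)} = \<pi> ` {v \<in> I. x (\<pi> v) \<le> x (\<pi> u)}"
    by (auto simp: image_iff)
  then show ?thesis
    using card_image[OF permutes_inj_on[OF assms], of "{v \<in> I. x (\<pi> v) \<le> x (\<pi> u)}"]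
    by (simp add: rank_on_def)
qed

text \<open>For injective \<open>f\<close> this is one of the simplices into which the cube is cut
  by the hyperplanes x_u = x_v.\<close>

definition increasing_along :: "'i set \<Rightarrow> ('i \<Rightarrow> nat) \<Rightarrow> ('i \<Rightarrow> real) set" where
  "increasing_along I f = {x \<in> space (cube I). \<forall>u\<in>I. \<forall>v\<in>I. f u < f v \<longrightarrow> x u < x v}"

lemma sets_increasing_along [measurable]:
  assumes "finite I"
  shows "increasing_along I f \<in> sets (cube I)"
  using assms countable_finite[OF assms] unfolding increasing_along_def by measurable

lemma increasing_along_less_iff:
  assumes "inj_on f I" "x \<in> increasing_along I f" "u \<in> I" "v \<in> I"
  shows "x u < x v \<longleftrightarrow> f u < f v"
proof -
  have less: "x u < x v" if "u \<in> I" "v \<in> I" "f u < f v" for u v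
    using assms(2) that by (simp add: increasing_along_def)
  consider "f u < f v" | "f v < f u" | "u = v"
    using inj_onD[OF assms(1) _ assms(3,4)] by (cases "f u" "f v" rule: linorder_cases) auto
  then show ?thesis
    using less[OF assms(3,4)] less[OF assms(4,3)] by cases auto
qed

lemma ex1_permutes_increasing_along:
  assumes I: "finite I" and f: "inj_on f I" and x: "inj_on x I" "x \<in> space (cube I)"
  shows "\<exists>!\<pi>. \<pi> permutes I \<and> x \<circ> \<pi> \<in> increasing_along I f"
proof -
  note bx = bij_betw_rank_on[OF I x(1)]
  note bf = bij_betw_rank_on[OF I f]
  \<comment> \<open>In terms of ranks the condition becomes an equation for \<open>\<pi> u\<close>.
    As the ranks of \<open>x\<close> are bijective, it has exactly one solution, the
    \<open>\<sigma>\<close> below.\<close>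
  have key: "x \<circ> \<pi> \<in> increasing_along I f \<longleftrightarrow> (\<forall>u\<in>I. rank_on I x (\<pi> u) = rank_on I f u)"
    if \<pi>: "\<pi> permutes I" for \<pi>
  proof
    assume "x \<circ> \<pi> \<in> increasing_along I f"
    then show "\<forall>u\<in>I. rank_on I x (\<pi> u) = rank_on I f u"
      unfolding rank_on_comp_permutes[OF \<pi>, symmetric]
      by (intro ballI rank_on_cong increasing_along_less_iff[OF f])
  next
    assume *: "\<forall>u\<in>I. rank_on I x (\<pi> u) = rank_on I f u"
    have "x (\<pi> u) < x (\<pi> v)" if "u \<in> I" "v \<in> I" "f u < f v" for u v
    proof -
      have "\<pi> u \<in> I" "\<pi> v \<in> I" using \<pi> that by (auto simp: permutes_in_image)
      then show ?thesis
        using * that rank_on_less_iff[OF I, of "\<pi> u" "\<pi> v" x] rank_on_less_iff[OF I that(1,2), of f]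
        by simp
    qed
    moreover have "x \<circ> \<pi> \<in> space (cube I)"
      using measurable_space[OF measurable_cube_permutes[OF \<pi>] x(2)] .
    ultimately show "x \<circ> \<pi> \<in> increasing_along I f"
      by (auto simp: increasing_along_def)
  qed
  define \<sigma> where "\<sigma> u = (if u \<in> I then inv_into I (rank_on I x) (rank_on I f u) else u)" for u
  have "bij_betw (inv_into I (rank_on I x) \<circ> rank_on I f) I I"
    using bf bij_betw_inv_into[OF bx] by (rule bij_betw_trans)
  then have "bij_betw \<sigma> I I"
    by (rule bij_betw_cong[THEN iffD1, rotated]) (simp add: \<sigma>_def)
  then have \<sigma>: "\<sigma> permutes I"
    by (rule bij_imp_permutes) (simp add: \<sigma>_def)
  have \<sigma>r: "rank_on I x (\<sigma> u) = rank_on I f u" if "u \<in> I" for u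
    using that bij_betw_inv_into_right[OF bx, of "rank_on I f u"] bij_betwE[OF bf]
    by (auto simp: \<sigma>_def)
  show ?thesis
  proof (rule ex1I[of _ \<sigma>])
    show "\<sigma> permutes I \<and> x \<circ> \<sigma> \<in> increasing_along I f"
      using \<sigma> \<sigma>r key by auto
  next
    fix \<pi> assume \<pi>: "\<pi> permutes I \<and> x \<circ> \<pi> \<in> increasing_along I f"
    show "\<pi> = \<sigma>"
    proof
      fix u
      show "\<pi> u = \<sigma> u"
      proof (cases "u \<in> I")
        case True
        then have "rank_on I x (\<pi> u) = rank_on I x (\<sigma> u)" using \<pi> key \<sigma>r by auto
        moreover have "\<pi> u \<in> I" "\<sigma> u \<in> I" using \<pi> \<sigma> True by (auto simp: permutes_in_image)
        ultimately show ?thesis using bx by (auto simp: bij_betw_def dest: inj_onD)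
      next
        case False
        then show ?thesis using \<pi> by (auto simp: \<sigma>_def permutes_def)
      qed
    qed
  qed
qed

text \<open>Almost every point is moved into the simplex of \<open>f\<close> by exactly one
  permutation, so \<open>g\<close> is almost everywhere the sum of the permuted copies of its
  restriction to that simplex. All these copies have the same integral.\<close>

lemma integral_cube_symmetric:
  fixes g :: "('i \<Rightarrow> real) \<Rightarrow> real"
  assumes I: "finite I" and f: "inj_on f I" and g: "integrable (cube I) g"
    and sym: "\<And>\<pi> x. \<pi> permutes I \<Longrightarrow> g (x \<circ> \<pi>) = g x"
  shows "(\<integral>x. g x \<partial>cube I) = fact (card I) * (\<integral>x. indicator (increasing_along I f) x * g x \<partial>cube I)"
proof -
  let ?S = "increasing_along I f" and ?M = "cube I" and ?Perm = "{\<pi>. \<pi> permutes I}"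
  have [measurable]: "g \<in> borel_measurable ?M" using g by auto
  have [measurable]: "?S \<in> sets ?M" using I by measurable
  have fin: "finite ?Perm" using I by (rule finite_permutations)
  let ?k = "\<lambda>x. indicator ?S x * g x"
  have k [measurable]: "?k \<in> borel_measurable ?M" by measurable
  have ik: "integrable ?M ?k"
    using integrable_real_mult_indicator[OF \<open>?S \<in> sets ?M\<close> g] by (simp add: mult.commute)
  have ik': "integrable ?M (\<lambda>x. ?k (x \<circ> \<pi>))" if "\<pi> permutes I" for \<pi>
    by (rule integrable_distr[OF measurable_cube_permutes[OF that]])
       (use ik in \<open>simp add: distr_cube_permutes[OF that]\<close>)
  define h where "h x = (\<Sum>\<pi>\<in>?Perm. ?k (x \<circ> \<pi>))" for x
  have g_eq_h: "g x = h x" if x: "inj_on x I" "x \<in> space ?M" for x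
  proof -
    obtain \<sigma> where \<sigma>: "\<sigma> permutes I" "x \<circ> \<sigma> \<in> ?S"
      "\<And>\<pi>. \<pi> permutes I \<Longrightarrow> x \<circ> \<pi> \<in> ?S \<Longrightarrow> \<pi> = \<sigma>"
      using ex1_permutes_increasing_along[OF I f x] by blast
    have single: "(\<Sum>\<pi>\<in>?Perm. ?k (x \<circ> \<pi>)) = (\<Sum>\<pi>\<in>?Perm. if \<pi> = \<sigma> then g x else 0)"
    proof (intro sum.cong refl)
      fix \<pi> assume "\<pi> \<in> ?Perm"
      then have \<pi>: "\<pi> permutes I" by simp
      show "?k (x \<circ> \<pi>) = (if \<pi> = \<sigma> then g x else 0)"
      proof (cases "\<pi> = \<sigma>")
        case True
        then show ?thesis using \<sigma>(2) sym[OF \<pi>, of x] by simp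
      next
        case False
        then have "x \<circ> \<pi> \<notin> ?S" using \<sigma>(3)[OF \<pi>] by blast
        then show ?thesis using False by simp
      qed
    qed
    have g_eq: "(\<Sum>\<pi>\<in>?Perm. if \<pi> = \<sigma> then g x else 0) = g x"
      using \<sigma>(1) fin by simp
    show ?thesis unfolding h_def single g_eq ..
  qed
  have "(\<integral>x. g x \<partial>?M) = (\<integral>x. h x \<partial>?M)"
  proof (rule integral_cong_AE)
    show "h \<in> borel_measurable ?M"
      unfolding h_def using ik' by (intro borel_measurable_sum) auto
    show "AE x in ?M. g x = h x"
      using AE_cube_inj_on[OF I] AE_space by eventually_elim (rule g_eq_h)
  qed (rule borel_measurable_integrable[OF g])
  also have "\<dots> = (\<Sum>\<pi>\<in>?Perm. (\<integral>x. ?k (x \<circ> \<pi>) \<partial>?M))"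
    unfolding h_def using ik' by (intro Bochner_Integration.integral_sum) auto
  also have "\<dots> = (\<Sum>\<pi>\<in>?Perm. (\<integral>x. ?k x \<partial>?M))"
    by (intro sum.cong refl integral_cube_permutes k) auto
  also have "\<dots> = fact (card I) * (\<integral>x. ?k x \<partial>?M)"
    using card_permutations[OF refl I] by simp
  finally show ?thesis .
qed

lemma measure_increasing_along:
  assumes "finite I" "inj_on f I"
  shows "measure (cube I) (increasing_along I f) = 1 / fact (card I)"
proof -
  have S: "increasing_along I f \<in> sets (cube I)" using assms by measurable
  have "1 = fact (card I) * measure (cube I) (increasing_along I f)"
    using integral_cube_symmetric[OF assms, of "\<lambda>_. 1"] S sets.sets_into_space[OF S]
      prob_space.prob_space[OF prob_space_PiM[of I "\<lambda>_. unit_measure"]]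
      prob_space.finite_measure[OF prob_space_PiM[of I "\<lambda>_. unit_measure"]]
    by (simp add: Int_absorb1 finite_measure.integrable_const)
  then show ?thesis by (simp add: field_simps)
qed

section \<open>Counting topological orderings by volume\<close>

definition arc_region :: "'a pair_pre_digraph \<Rightarrow> ('a \<Rightarrow> real) set" where
  "arc_region G = {x \<in> space (cube (pverts G)). \<forall>(u, v)\<in>parcs G. x v < x u}"

lemma sets_arc_region:
  assumes V: "finite (pverts G)" and A: "parcs G \<subseteq> pverts G \<times> pverts G"
  shows "arc_region G \<in> sets (cube (pverts G))"
proof -
  let ?M = "cube (pverts G)"
  have fA: "finite (parcs G)"
    using A V by (meson finite_SigmaI finite_subset)
  have "arc_region G = {x \<in> space ?M. \<forall>p\<in>parcs G. x (snd p) < x (fst p)}"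
    by (auto simp: arc_region_def)
  also have "\<dots> \<in> sets ?M"
  proof (intro sets.sets_Collect_finite_All fA)
    show "{x \<in> space ?M. x (snd p) < x (fst p)} \<in> sets ?M" if "p \<in> parcs G" for p
    proof -
      have "fst p \<in> pverts G" "snd p \<in> pverts G" using that A by auto
      then show ?thesis by measurable
    qed
  qed
  finally show ?thesis .
qed

text \<open>Up to ties, the arc region is the disjoint union of the simplices of the topological
  orderings: an injective label vector lies in the region iff its ranking is such an ordering, and
  it then lies in that simplex only.\<close>

lemma topo_eq_measure:
  assumes V: "finite (pverts G)" and A: "parcs G \<subseteq> pverts G \<times> pverts G"
  shows "real (topo G) = fact (card (pverts G)) * measure (cube (pverts G)) (arc_region G)"
proof -
  define S where "S = arc_region G"
  let ?V = "pverts G" and ?TO = "topological_orderings G"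
  let ?M = "cube ?V"
  have TO: "bij_betw f ?V {1..card ?V}" "f \<in> extensional ?V" if "f \<in> ?TO" for f
    using that by (auto simp: topological_orderings_def)
  have inj: "inj_on f ?V" if "f \<in> ?TO" for f
    using TO[OF that] by (auto simp: bij_betw_def)
  have "?TO \<subseteq> ?V \<rightarrow>\<^sub>E {1..card ?V}"
    using TO by (auto simp: PiE_def bij_betw_def)
  then have fin: "finite ?TO"
    by (rule finite_subset) (use V in \<open>auto intro!: finite_PiE\<close>)
  note S = sets_arc_region[OF V A, folded S_def]
  have "measure ?M S = (\<integral>x. indicator S x \<partial>?M)"
    using S sets.sets_into_space[OF S] by (simp add: Int_absorb1)
  also have "\<dots> = (\<integral>x. (\<Sum>f\<in>?TO. indicator (increasing_along ?V f) x) \<partial>?M)"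
  proof (rule integral_cong_AE)
    show "AE x in ?M. (indicator S x :: real) = (\<Sum>f\<in>?TO. indicator (increasing_along ?V f) x)"
      using AE_cube_inj_on[OF V] AE_space
    proof eventually_elim
      case (elim x)
      \<comment> \<open>Topological orderings are extensional, so the ranking must be restricted
        before it can equal one of them as a function.\<close>
      define r where "r = restrict (rank_on ?V x) ?V"
      have rless: "r u < r v \<longleftrightarrow> x u < x v" if "u \<in> ?V" "v \<in> ?V" for u v
        using rank_on_less_iff[OF V that, of x] that by (simp add: r_def)
      have rbij: "bij_betw r ?V {1..card ?V}"
        using bij_betw_rank_on[OF V elim(1)] unfolding r_def
        by (rule bij_betw_cong[THEN iffD1, rotated]) simp
      have rTO: "r \<in> ?TO \<longleftrightarrow> x \<in> S"
      proof -
        have "r v < r u \<longleftrightarrow> x v < x u" if "(u, v) \<in> parcs G" for u v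
          using that A rless by auto
        moreover have "r \<in> extensional ?V" by (simp add: r_def)
        ultimately show ?thesis
          using rbij elim(2) unfolding topological_orderings_def S_def arc_region_def by fast
      qed
      have uniq: "x \<in> increasing_along ?V f \<longleftrightarrow> f = r" if f: "f \<in> ?TO" for f
      proof
        assume x: "x \<in> increasing_along ?V f"
        have "f u = r u" if u: "u \<in> ?V" for u
          using rank_on_cong[of ?V x f u] increasing_along_less_iff[OF inj[OF f] x] u
            rank_on_bij_betw[OF TO(1)[OF f] u] by (simp add: r_def)
        then show "f = r"
          using TO(2)[OF f] by (intro extensionalityI[of _ ?V]) (auto simp: r_def)
      next
        assume "f = r"
        then show "x \<in> increasing_along ?V f"
          using rless elim(2) by (auto simp: increasing_along_def)
      qed
      have "(\<Sum>f\<in>?TO. indicator (increasing_along ?V f) x) = (\<Sum>f\<in>?TO. if f = r then 1 else (0::real))"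
        using uniq by (intro sum.cong refl) (auto simp: indicator_def)
      also have "\<dots> = indicator S x"
        using fin rTO by (simp add: sum.delta indicator_def)
      finally show ?case by simp
    qed
  qed (use S sets_increasing_along[OF V] in \<open>auto intro!: borel_measurable_sum borel_measurable_indicator\<close>)
  also have "\<dots> = (\<Sum>f\<in>?TO. measure ?M (increasing_along ?V f))"
  proof (subst Bochner_Integration.integral_sum)
    show "integrable ?M (indicator (increasing_along ?V f) :: _ \<Rightarrow> real)" for f
      using sets_increasing_along[OF V] by (intro integrable_cube_bounded[where C = 1]) (auto simp: indicator_def)
    have "increasing_along ?V f \<inter> space ?M = increasing_along ?V f" for f
      by (auto simp: increasing_along_def)
    then show "(\<Sum>f\<in>?TO. \<integral>x. indicator (increasing_along ?V f) x \<partial>?M) =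
        (\<Sum>f\<in>?TO. measure ?M (increasing_along ?V f))"
      by simp
  qed
  also have "\<dots> = (\<Sum>f\<in>?TO. 1 / fact (card ?V))"
    by (intro sum.cong refl measure_increasing_along V inj)
  finally show ?thesis by (simp add: topo_def S_def)
qed

section \<open>The Selberg graph\<close>

definition pairs :: "nat \<Rightarrow> (nat \<times> nat) set" where
  "pairs n = {(i, j). 1 \<le> i \<and> i < j \<and> j \<le> n}"

lemma finite_pairs [simp]: "finite (pairs n)"
  by (rule finite_subset[of _ "{..n} \<times> {..n}"]) (auto simp: pairs_def)

lemma card_pairs: "card (pairs n) = n choose 2"
proof (induction n)
  case 0
  have "pairs 0 = {}" by (auto simp: pairs_def)
  then show ?case by simp
next
  case (Suc n)
  have "pairs (Suc n) = pairs n \<union> (\<lambda>i. (i, Suc n)) ` {1..n}"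
    by (auto simp: pairs_def image_iff)
  moreover have "card (pairs n \<union> (\<lambda>i. (i, Suc n)) ` {1..n}) = card (pairs n) + n"
  proof (subst card_Un_disjoint)
    show "pairs n \<inter> (\<lambda>i. (i, Suc n)) ` {1..n} = {}" by (auto simp: pairs_def)
  qed (simp_all add: card_image inj_on_def)
  ultimately show ?case
    using Suc by (simp add: numeral_2_eq_2)
qed

text \<open>Every unordered pair occurs once in each order. This leads from the order-free product
  in \<open>selberg_weight\<close> to the pairs i < j that index the \<open>R\<close>
  vertices.\<close>

lemma prod_distinct_pairs:
  fixes g :: "nat \<Rightarrow> nat \<Rightarrow> 'a::comm_monoid_mult"
  shows "(\<Prod>i\<in>{1..n}. \<Prod>j\<in>{1..n} - {i}. g i j) = (\<Prod>(i, j)\<in>pairs n. g i j * g j i)"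
proof -
  have "(\<Prod>i\<in>{1..n}. \<Prod>j\<in>{1..n} - {i}. g i j) = (\<Prod>(i, j)\<in>Sigma {1..n} (\<lambda>i. {1..n} - {i}). g i j)"
    by (rule prod.Sigma) auto
  also have "Sigma {1..n} (\<lambda>i. {1..n} - {i}) = pairs n \<union> prod.swap ` pairs n"
    by (auto simp: pairs_def image_iff)
  also have "(\<Prod>(i, j)\<in>pairs n \<union> prod.swap ` pairs n. g i j) =
      (\<Prod>(i, j)\<in>pairs n. g i j) * (\<Prod>(i, j)\<in>prod.swap ` pairs n. g i j)"
    by (intro prod.union_disjoint finite_imageI finite_pairs) (auto simp: pairs_def)
  also have "(\<Prod>(i, j)\<in>prod.swap ` pairs n. g i j) = (\<Prod>(i, j)\<in>pairs n. g j i)"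
    by (subst prod.reindex) (auto simp: case_prod_beta)
  finally show ?thesis
    by (simp add: prod.distrib[symmetric] case_prod_beta)
qed

definition X_verts :: "nat \<Rightarrow> selberg_vertex set" where
  "X_verts n = X ` {1..n}"

text \<open>Written as injective images of Cartesian products, so that cardinalities and products
  follow by reindexing.\<close>

definition side_verts :: "nat \<Rightarrow> nat \<Rightarrow> nat \<Rightarrow> nat \<Rightarrow> selberg_vertex set" where
  "side_verts n a b c = (\<lambda>(i, k). P i k) ` ({1..n} \<times> {1..a - 1}) \<union>
     ((\<lambda>(i, k). Q i k) ` ({1..n} \<times> {1..b - 1}) \<union>
      (\<lambda>((i, j), k). R i j k) ` (pairs n \<times> {1..2 * c}))"

lemma finite_X_verts [simp]: "finite (X_verts n)"
  by (simp add: X_verts_def)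

lemma finite_side_verts [simp]: "finite (side_verts n a b c)"
  by (simp add: side_verts_def)

lemma X_side_verts_disjoint: "X_verts n \<inter> side_verts n a b c = {}"
  by (auto simp: X_verts_def side_verts_def)

lemma pverts_G_S: "pverts (G_S n a b c) = X_verts n \<union> side_verts n a b c"
  by (auto simp: G_S_def X_verts_def side_verts_def pairs_def image_iff)

lemma parcs_G_S_subset: "parcs (G_S n a b c) \<subseteq> pverts (G_S n a b c) \<times> pverts (G_S n a b c)"
  by (auto simp: G_S_def)

lemma prod_X_verts: "(\<Prod>v\<in>X_verts n. g v) = (\<Prod>i\<in>{1..n}. g (X i))"
  unfolding X_verts_def by (subst prod.reindex) (auto simp: inj_on_def)

lemma prod_side_verts:
  "(\<Prod>v\<in>side_verts n a b c. g v) =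
    (\<Prod>i\<in>{1..n}. \<Prod>k\<in>{1..a - 1}. g (P i k)) * ((\<Prod>i\<in>{1..n}. \<Prod>k\<in>{1..b - 1}. g (Q i k)) *
    (\<Prod>(i, j)\<in>pairs n. \<Prod>k\<in>{1..2 * c}. g (R i j k)))"
proof -
  have "(\<Prod>v\<in>side_verts n a b c. g v) = (\<Prod>v\<in>(\<lambda>(i, k). P i k) ` ({1..n} \<times> {1..a - 1}). g v) *
      ((\<Prod>v\<in>(\<lambda>(i, k). Q i k) ` ({1..n} \<times> {1..b - 1}). g v) *
       (\<Prod>v\<in>(\<lambda>((i, j), k). R i j k) ` (pairs n \<times> {1..2 * c}). g v))"
    unfolding side_verts_def
    by (subst prod.union_disjoint, simp, simp, force)+ simp
  also have "(\<Prod>v\<in>(\<lambda>(i, k). P i k) ` ({1..n} \<times> {1..a - 1}). g v) = (\<Prod>i\<in>{1..n}. \<Prod>k\<in>{1..a - 1}. g (P i k))"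
    by (subst prod.reindex) (auto simp: inj_on_def prod.cartesian_product case_prod_beta)
  also have "(\<Prod>v\<in>(\<lambda>(i, k). Q i k) ` ({1..n} \<times> {1..b - 1}). g v) = (\<Prod>i\<in>{1..n}. \<Prod>k\<in>{1..b - 1}. g (Q i k))"
    by (subst prod.reindex) (auto simp: inj_on_def prod.cartesian_product case_prod_beta)
  also have "(\<Prod>v\<in>(\<lambda>((i, j), k). R i j k) ` (pairs n \<times> {1..2 * c}). g v) =
      (\<Prod>(i, j)\<in>pairs n. \<Prod>k\<in>{1..2 * c}. g (R i j k))"
    by (subst prod.reindex) (auto simp: inj_on_def prod.cartesian_product case_prod_beta)
  finally show ?thesis .
qed

lemma card_pverts_G_S:
  assumes "a \<ge> 1" "b \<ge> 1"
  shows "card (pverts (G_S n a b c)) = n * (a + b - 1) + (n choose 2) * (2 * c)"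
proof -
  have inj: "inj_on (\<lambda>(i, k). P i k) A" "inj_on (\<lambda>(i, k). Q i k) A"
    "inj_on (\<lambda>((i, j), k). R i j k) B" for A B
    by (auto simp: inj_on_def)
  have "card (side_verts n a b c) = n * (a - 1) + (n * (b - 1) + (n choose 2) * (2 * c))"
    unfolding side_verts_def
    by (subst card_Un_disjoint, simp, simp, force)+
       (simp add: card_image inj card_cartesian_product card_pairs)
  moreover have "card (X_verts n) = n"
    unfolding X_verts_def by (subst card_image) (auto simp: inj_on_def)
  ultimately have "card (pverts (G_S n a b c)) = n + (n * (a - 1) + (n * (b - 1) + (n choose 2) * (2 * c)))"
    unfolding pverts_G_S by (subst card_Un_disjoint) (auto simp: X_side_verts_disjoint)
  moreover have "n + (n * (a - 1) + n * (b - 1)) = n * (a + b - 1)"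
    using assms by (cases a; cases b) (auto simp: algebra_simps)
  ultimately show ?thesis by simp
qed

section \<open>Integrating out the side vertices\<close>

text \<open>The reference ordering on \<open>X_verts n\<close>, where it is injective; its simplex
  is x_1 < ... < x_n.\<close>

primrec vertex_index :: "selberg_vertex \<Rightarrow> nat" where
  "vertex_index (X i) = i"
| "vertex_index (P i k) = 0"
| "vertex_index (Q i k) = 0"
| "vertex_index (R i j k) = 0"

lemma increasing_along_X_verts:
  "x \<in> increasing_along (X_verts n) vertex_index \<longleftrightarrow>
    x \<in> space (cube (X_verts n)) \<and> (\<forall>(i, j)\<in>pairs n. x (X i) < x (X j))"
  by (auto simp: increasing_along_def X_verts_def pairs_def)

text \<open>The graph has arcs between consecutive \<open>X\<close> vertices only, whereas the
  simplex and the \<open>R\<close> intervals involve all pairs; transitivity bridges the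
  two.\<close>

lemma chain_iff_pairs:
  fixes x :: "selberg_vertex \<Rightarrow> real"
  shows "(\<forall>i\<in>{1..n - 1}. x (X i) < x (X (i + 1))) \<longleftrightarrow> (\<forall>(i, j)\<in>pairs n. x (X i) < x (X j))"
proof
  assume *: "\<forall>i\<in>{1..n - 1}. x (X i) < x (X (i + 1))"
  have "x (X i) < x (X j)" if "i < j" "1 \<le> i" "j \<le> n" for i j
    using that
  proof (induction j)
    case (Suc j)
    have step: "x (X j) < x (X (Suc j))" using * Suc.prems by auto
    show ?case
    proof (cases "i = j")
      case False
      then have "x (X i) < x (X j)" using Suc by auto
      with step show ?thesis by simp
    qed (use step in simp)
  qed simp
  then show "\<forall>(i, j)\<in>pairs n. x (X i) < x (X j)" by (auto simp: pairs_def)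
qed (auto simp: pairs_def)

text \<open>Given the positions of the \<open>X\<close> vertices, the arcs confine each side vertex to an interval,
  independently of the other side vertices.\<close>

primrec side_interval :: "(selberg_vertex \<Rightarrow> real) \<Rightarrow> selberg_vertex \<Rightarrow> real set" where
  "side_interval x (X i) = {}"
| "side_interval x (P i k) = {0..<x (X i)}"
| "side_interval x (Q i k) = {x (X i)<..1}"
| "side_interval x (R i j k) = {x (X i)<..<x (X j)}"

primrec side_length :: "(selberg_vertex \<Rightarrow> real) \<Rightarrow> selberg_vertex \<Rightarrow> real" where
  "side_length x (X i) = 0"
| "side_length x (P i k) = x (X i)"
| "side_length x (Q i k) = 1 - x (X i)"
| "side_length x (R i j k) = x (X j) - x (X i)"

lemma all_selberg_vertex:
  "(\<forall>v. \<phi> v) \<longleftrightarrow> (\<forall>i. \<phi> (X i)) \<and> (\<forall>i k. \<phi> (P i k)) \<and> (\<forall>i k. \<phi> (Q i k)) \<and> (\<forall>i j k. \<phi> (R i j k))"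
proof
  assume *: "(\<forall>i. \<phi> (X i)) \<and> (\<forall>i k. \<phi> (P i k)) \<and> (\<forall>i k. \<phi> (Q i k)) \<and> (\<forall>i j k. \<phi> (R i j k))"
  show "\<forall>v. \<phi> v"
  proof
    fix v show "\<phi> v" using * by (cases v) auto
  qed
qed simp

text \<open>No arc joins two side vertices. For fixed \<open>x\<close> the arc conditions therefore
  decouple into the chain condition on \<open>x\<close> and one interval condition per side vertex,
  which is a box in \<open>y\<close>.\<close>

lemma arcs_G_S_merge_iff:
  assumes x: "x \<in> space (cube (X_verts n))" and y: "y \<in> space (cube (side_verts n a b c))"
  defines "z \<equiv> merge (X_verts n) (side_verts n a b c) (x, y)"
  shows "(\<forall>(u, v)\<in>parcs (G_S n a b c). z v < z u) \<longleftrightarrow>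
    x \<in> increasing_along (X_verts n) vertex_index \<and>
    y \<in> Pi\<^sub>E (side_verts n a b c) (side_interval x)"
proof -
  have zX: "z (X i) = x (X i)" if "1 \<le> i" "i \<le> n" for i
    using that by (auto simp: z_def merge_def X_verts_def)
  have zS: "z v = y v" if "v \<in> side_verts n a b c" for v
    using that X_side_verts_disjoint[of n a b c] by (auto simp: z_def merge_def)
  have PS: "P i k \<in> side_verts n a b c \<longleftrightarrow> i \<in> {1..n} \<and> k \<in> {1..a - 1}"
    and QS: "Q i k \<in> side_verts n a b c \<longleftrightarrow> i \<in> {1..n} \<and> k \<in> {1..b - 1}"
    and RS: "R i j k \<in> side_verts n a b c \<longleftrightarrow> (i, j) \<in> pairs n \<and> k \<in> {1..2 * c}"
    and XS: "X i \<notin> side_verts n a b c" for i j k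
    by (auto simp: side_verts_def) force
  \<comment> \<open>A \<open>P\<close> or \<open>Q\<close> vertex gets only one bound from its arc;
    the other end of its interval comes from the cube.\<close>
  have y01: "0 \<le> y v \<and> y v \<le> 1" if "v \<in> side_verts n a b c" for v
    using cube_component_bounds[OF y that] .
  have ye: "y \<in> extensional (side_verts n a b c)"
    using y by (auto simp: space_cube PiE_def)
  have "(\<forall>(u, v)\<in>parcs (G_S n a b c). z v < z u) \<longleftrightarrow>
      (\<forall>i\<in>{1..n - 1}. z (X i) < z (X (i + 1))) \<and>
      (\<forall>i k. P i k \<in> side_verts n a b c \<longrightarrow> z (P i k) < z (X i)) \<and>
      (\<forall>i k. Q i k \<in> side_verts n a b c \<longrightarrow> z (X i) < z (Q i k)) \<and>
      (\<forall>i j k. R i j k \<in> side_verts n a b c \<longrightarrow> z (R i j k) < z (X j) \<and> z (X i) < z (R i j k))"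
    unfolding PS QS RS by (auto simp: G_S_def pairs_def)
  also have "(\<forall>i\<in>{1..n - 1}. z (X i) < z (X (i + 1))) \<longleftrightarrow> (\<forall>(i, j)\<in>pairs n. x (X i) < x (X j))"
    unfolding chain_iff_pairs by (auto simp: pairs_def zX)
  also have "(\<forall>i k. P i k \<in> side_verts n a b c \<longrightarrow> z (P i k) < z (X i)) \<longleftrightarrow>
      (\<forall>i k. P i k \<in> side_verts n a b c \<longrightarrow> y (P i k) \<in> side_interval x (P i k))"
    using y01 by (auto simp: zS) (auto simp: PS zX)
  also have "(\<forall>i k. Q i k \<in> side_verts n a b c \<longrightarrow> z (X i) < z (Q i k)) \<longleftrightarrow>
      (\<forall>i k. Q i k \<in> side_verts n a b c \<longrightarrow> y (Q i k) \<in> side_interval x (Q i k))"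
    using y01 by (auto simp: zS) (auto simp: QS zX)
  also have "(\<forall>i j k. R i j k \<in> side_verts n a b c \<longrightarrow> z (R i j k) < z (X j) \<and> z (X i) < z (R i j k)) \<longleftrightarrow>
      (\<forall>i j k. R i j k \<in> side_verts n a b c \<longrightarrow> y (R i j k) \<in> side_interval x (R i j k))"
    by (auto simp: zS) (auto simp: RS zX pairs_def)
  also have "(\<forall>(i, j)\<in>pairs n. x (X i) < x (X j)) \<and>
      (\<forall>i k. P i k \<in> side_verts n a b c \<longrightarrow> y (P i k) \<in> side_interval x (P i k)) \<and>
      (\<forall>i k. Q i k \<in> side_verts n a b c \<longrightarrow> y (Q i k) \<in> side_interval x (Q i k)) \<and>
      (\<forall>i j k. R i j k \<in> side_verts n a b c \<longrightarrow> y (R i j k) \<in> side_interval x (R i j k)) \<longleftrightarrow>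
      (\<forall>(i, j)\<in>pairs n. x (X i) < x (X j)) \<and> (\<forall>v\<in>side_verts n a b c. y v \<in> side_interval x v)"
    using XS by (simp add: Ball_def all_selberg_vertex del: side_interval.simps)
  finally show ?thesis
    using x ye by (auto simp: increasing_along_X_verts PiE_def Pi_def)
qed

text \<open>The chain condition on \<open>x\<close> ensures x_i < x_j for the \<open>R\<close>
  intervals; if x_j < x_i, the length x_j - x_i would be negative and not the measure of the empty
  interval.\<close>

lemma side_interval_measure:
  assumes x: "x \<in> increasing_along (X_verts n) vertex_index" and v: "v \<in> side_verts n a b c"
  shows "side_interval x v \<in> sets unit_measure"
    and "emeasure unit_measure (side_interval x v) = ennreal (side_length x v)"
    and "0 \<le> side_length x v"
proof -
  have xp: "x (X i) < x (X j)" if "(i, j) \<in> pairs n" for i j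
    using x that by (auto simp: increasing_along_X_verts)
  have xs: "x \<in> space (cube (X_verts n))"
    using x by (auto simp: increasing_along_X_verts)
  have bounds: "0 \<le> x (X i)" "x (X i) \<le> 1" if "i \<in> {1..n}" for i
    using cube_component_bounds[OF xs, of "X i"] that by (auto simp: X_verts_def)
  have sub: "side_interval x v \<subseteq> {0..1} \<and> side_interval x v \<in> sets borel \<and>
      emeasure lborel (side_interval x v) = ennreal (side_length x v) \<and> 0 \<le> side_length x v"
  proof (cases v)
    case (X i)
    then show ?thesis using v by (auto simp: side_verts_def)
  next
    case (P i k)
    then have "i \<in> {1..n}" using v by (auto simp: side_verts_def)
    then show ?thesis using bounds[of i] P by auto
  next
    case (Q i k)
    then have "i \<in> {1..n}" using v by (auto simp: side_verts_def)
    then show ?thesis using bounds[of i] Q by auto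
  next
    case (R i j k)
    then have ij: "(i, j) \<in> pairs n" using v by (auto simp: side_verts_def)
    then have "i \<in> {1..n}" "j \<in> {1..n}" by (auto simp: pairs_def)
    then show ?thesis using bounds[of i] bounds[of j] xp[OF ij] R by auto
  qed
  then show "side_interval x v \<in> sets unit_measure" "0 \<le> side_length x v"
    "emeasure unit_measure (side_interval x v) = ennreal (side_length x v)"
    by (auto simp: sets_unit_measure emeasure_unit_measure)
qed

text \<open>The a - 1 vertices \<open>P\<close> below x_i give x_i^(a - 1), the b - 1 vertices
  \<open>Q\<close> above it give (1 - x_i)^(b - 1), and the 2c vertices \<open>R\<close> between x_i
  and x_j give (x_j - x_i)^(2c).\<close>

lemma prod_side_length:
  assumes x: "x \<in> increasing_along (X_verts n) vertex_index"
  shows "(\<Prod>v\<in>side_verts n a b c. side_length x v) = selberg_weight (X_verts n) (a - 1) (b - 1) c x"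
proof -
  have xp: "x (X i) < x (X j)" if "(i, j) \<in> pairs n" for i j
    using x that by (auto simp: increasing_along_X_verts)
  have diff: "X_verts n - {X i} = X ` ({1..n} - {i})" for i
    by (auto simp: X_verts_def)
  have "(\<Prod>u\<in>X_verts n. \<Prod>v\<in>X_verts n - {u}. \<bar>x u - x v\<bar> ^ c) =
      (\<Prod>i\<in>{1..n}. \<Prod>j\<in>{1..n} - {i}. \<bar>x (X i) - x (X j)\<bar> ^ c)"
    unfolding prod_X_verts diff
    by (intro prod.cong refl, subst prod.reindex) (auto simp: inj_on_def)
  also have "\<dots> = (\<Prod>(i, j)\<in>pairs n. (x (X j) - x (X i)) ^ (2 * c))"
    unfolding prod_distinct_pairs
  proof (intro prod.cong refl, clarify)
    fix i j assume "(i, j) \<in> pairs n"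
    then show "\<bar>x (X i) - x (X j)\<bar> ^ c * \<bar>x (X j) - x (X i)\<bar> ^ c = (x (X j) - x (X i)) ^ (2 * c)"
      using xp[of i j] by (simp add: abs_if mult_2 power_add)
  qed
  finally show ?thesis
    unfolding prod_side_verts selberg_weight_def
    by (simp add: prod_X_verts prod.distrib mult.assoc)
qed

text \<open>Fubini with the \<open>X\<close> coordinates outside: the inner integral is the volume
  of a box when \<open>x\<close> is increasing and 0 otherwise.\<close>

lemma measure_arc_region_G_S:
  "measure (cube (pverts (G_S n a b c))) (arc_region (G_S n a b c)) =
    (\<integral>x. indicator (increasing_along (X_verts n) vertex_index) x *
       selberg_weight (X_verts n) (a - 1) (b - 1) c x \<partial>cube (X_verts n))"
proof -
  let ?U = "X_verts n" and ?W = "side_verts n a b c" and ?S = "arc_region (G_S n a b c)"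
  let ?V = "pverts (G_S n a b c)" and ?inc = "increasing_along (X_verts n) vertex_index"
  have S: "?S \<in> sets (cube ?V)"
    by (rule sets_arc_region[OF finite_pverts_G_S parcs_G_S_subset])
  have "measure (cube ?V) ?S = (\<integral>z. indicator ?S z \<partial>cube ?V)"
    using sets.sets_into_space[OF S] by (simp add: Int_absorb2)
  also have "\<dots> = (\<integral>x. (\<integral>y. indicator ?S (merge ?U ?W (x, y)) \<partial>cube ?W) \<partial>cube ?U)"
    unfolding pverts_G_S
  proof (rule cube.product_integral_fold)
    show "integrable (cube (?U \<union> ?W)) (indicator ?S :: _ \<Rightarrow> real)"
      using S unfolding pverts_G_S
      by (intro integrable_cube_bounded[where C = 1]) (auto simp: indicator_def)
  qed (auto simp: X_side_verts_disjoint)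
  also have "\<dots> = (\<integral>x. indicator ?inc x * selberg_weight ?U (a - 1) (b - 1) c x \<partial>cube ?U)"
  proof (intro Bochner_Integration.integral_cong refl)
    fix x assume x: "x \<in> space (cube ?U)"
    let ?box = "Pi\<^sub>E ?W (side_interval x)"
    have "merge ?U ?W (x, y) \<in> ?S \<longleftrightarrow> x \<in> ?inc \<and> y \<in> ?box" if y: "y \<in> space (cube ?W)" for y
    proof -
      have "merge ?U ?W (x, y) \<in> space (cube ?V)"
        using x y unfolding pverts_G_S space_cube
        by (auto simp: PiE_def Pi_def extensional_def merge_def)
      then show ?thesis using arcs_G_S_merge_iff[OF x y] by (simp add: arc_region_def)
    qed
    then have "(\<integral>y. indicator ?S (merge ?U ?W (x, y)) \<partial>cube ?W) =
        (\<integral>y. indicat_real ?inc x * indicat_real ?box y \<partial>cube ?W)"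
      by (intro Bochner_Integration.integral_cong refl) (auto simp: indicator_def)
    also have "\<dots> = indicator ?inc x * measure (cube ?W) (?box \<inter> space (cube ?W))"
      by simp
    also have "\<dots> = indicator ?inc x * selberg_weight ?U (a - 1) (b - 1) c x"
    proof (cases "x \<in> ?inc")
      case True
      note m = side_interval_measure[OF True]
      have "?box \<subseteq> space (cube ?W)"
        unfolding space_cube using sets.sets_into_space[OF m(1)]
        by (intro PiE_mono) auto
      moreover have "emeasure (cube ?W) ?box = (\<Prod>v\<in>?W. emeasure unit_measure (side_interval x v))"
        by (rule cube.emeasure_PiM) (use m(1) in auto)
      then have "emeasure (cube ?W) ?box = ennreal (\<Prod>v\<in>?W. side_length x v)"
        using m(2,3) by (simp add: prod_ennreal)
      \<comment> \<open>\<open>measure\<close> is the real part of an extended nonnegative number,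
        so the product of lengths is recovered only because the weight is nonnegative.\<close>
      ultimately show ?thesis
        using prod_side_length[OF True, of a b c]
          selberg_weight_bounds(1)[OF finite_X_verts x, of "a - 1" "b - 1" c]
        by (simp add: Int_absorb2 measure_def)
    qed simp
    finally show "(\<integral>y. indicator ?S (merge ?U ?W (x, y)) \<partial>cube ?W) =
      indicator ?inc x * selberg_weight ?U (a - 1) (b - 1) c x" .
  qed
  finally show ?thesis .
qed

theorem theorem1p5:
  fixes n a b c :: nat
  assumes "n \<ge> 1" and "a \<ge> 1" and "b \<ge> 1" and "c \<ge> 1"
  shows "real (topo (G_S n a b c)) =
    fact (n * (a + b - 1) + (n choose 2) * (2 * c)) *
    (\<Prod>j = 0..n - 1.
        (fact (a + c * j - 1) * fact (b + c * j - 1) * fact (c + c * j - 1)) /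
        (fact (c - 1) * fact (a + b + (j + n - 1) * c - 1)))"
proof -
  let ?U = "X_verts n" and ?N = "n * (a + b - 1) + (n choose 2) * (2 * c)"
  let ?inc = "increasing_along ?U vertex_index"
  have inj: "inj_on vertex_index ?U"
    by (auto simp: X_verts_def inj_on_def)
  have card: "card ?U = n"
    unfolding X_verts_def by (subst card_image) (auto simp: inj_on_def)
  have int: "integrable (cube ?U) (selberg_weight ?U (a - 1) (b - 1) c)"
    using integrable_selberg_moment[of ?U "{}" "a - 1" "b - 1" c] by simp
  have "selberg_integral ?U (a - 1) (b - 1) c =
      fact n * measure (cube (pverts (G_S n a b c))) (arc_region (G_S n a b c))"
    unfolding selberg_integral_def measure_arc_region_G_S
    using integral_cube_symmetric[OF _ inj int selberg_weight_permutes] card by simp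
  \<comment> \<open>The n! collects the factors j + 1 of \<open>selberg_product\<close>; it cancels
    against the \<open>fact n\<close> of the preceding equation, the number of orderings of the
    x_i.\<close>
  moreover have "selberg_integral ?U (a - 1) (b - 1) c = fact n *
    (\<Prod>j<n. (fact (a + c * j - 1) * fact (b + c * j - 1) * fact (c + c * j - 1)) /
        (fact (c - 1) * fact (a + b + (j + n - 1) * c - 1)))"
  proof -
    have "selberg_integral ?U (a - 1) (b - 1) c = selberg_product n (a - 1) (b - 1) c"
      using selberg_integral_eq[of ?U c "a - 1" "b - 1"] assms(4) card by simp
    also have "\<dots> = (\<Prod>j<n. real (j + 1) *
       ((fact (a + c * j - 1) * fact (b + c * j - 1) * fact (c + c * j - 1)) /
        (fact (c - 1) * fact (a + b + (j + n - 1) * c - 1))))"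
      unfolding selberg_product_def
    proof (intro prod.cong refl)
      fix j assume "j \<in> {..<n}"
      then have "a - 1 + (b - 1) + 1 + c * (n - 1 + j) = a + b + (j + n - 1) * c - 1"
        using assms by (auto simp: algebra_simps)
      moreover have "a - 1 + c * j = a + c * j - 1" "b - 1 + c * j = b + c * j - 1"
        using assms by auto
      ultimately show "fact (a - 1 + c * j) * fact (b - 1 + c * j) * (real (j + 1) * fact (c + c * j - 1)) /
          (fact (c - 1) * fact (a - 1 + (b - 1) + 1 + c * (n - 1 + j))) =
        real (j + 1) * ((fact (a + c * j - 1) * fact (b + c * j - 1) * fact (c + c * j - 1)) /
          (fact (c - 1) * fact (a + b + (j + n - 1) * c - 1)))"
        by (simp only: mult_ac times_divide_eq_right)
    qed
    also have "\<dots> = (\<Prod>j<n. real (j + 1)) *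
      (\<Prod>j<n. (fact (a + c * j - 1) * fact (b + c * j - 1) * fact (c + c * j - 1)) /
        (fact (c - 1) * fact (a + b + (j + n - 1) * c - 1)))"
      by (rule prod.distrib)
    also have "(\<Prod>j<n. real (j + 1)) = fact n"
      by (simp add: fact_prod_Suc atLeast0LessThan)
    finally show ?thesis .
  qed
  ultimately have "measure (cube (pverts (G_S n a b c))) (arc_region (G_S n a b c)) =
    (\<Prod>j<n. (fact (a + c * j - 1) * fact (b + c * j - 1) * fact (c + c * j - 1)) /
        (fact (c - 1) * fact (a + b + (j + n - 1) * c - 1)))"
    by simp
  moreover have "real (topo (G_S n a b c)) =
      fact ?N * measure (cube (pverts (G_S n a b c))) (arc_region (G_S n a b c))"
    using topo_eq_measure[OF finite_pverts_G_S parcs_G_S_subset, of n a b c]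
    unfolding card_pverts_G_S[OF assms(2,3)] .
  \<comment> \<open>Needs n >= 1: at n = 0 truncated subtraction would make the left side
    \<open>{0}\<close>.\<close>
  moreover have "{0..n - 1} = {..<n}" using assms(1) by auto
  ultimately show ?thesis by simp
qed

end
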